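(* Let $\mathbf{P}$ be a compact interval. Suppose $(A,B)\in C_{n,n}(\mathbf{P}) \times C_{n,m}(\mathbf{P})$ is pointwise reachable and that there exists a $v\in \mathbb{C}^m$ with $B(\theta)v\neq0$ for all $\theta\in\mathbf{P}$. Then there exists a $K\in C_{m,n}(\mathbf{P})$ such that $(A+B K,B)$ is uniformly ensemble reachable.
   Context: $C_n(\mathbf{P})$ and $C_{n,m}(\mathbf{P})$ denote the spaces of continuous functions on $\mathbf{P}$ with values in $\mathbb{C}^n$, respectively $\mathbb{C}^{n\times m}$; $C_n(\mathbf{P})$ carries the supremum norm. A pair $(A,B)$ is pointwise reachable if for every $\theta\in\mathbf{P}$ the pair $(A(\theta),B(\theta))$ is reachable, i.e. $\operatorname{rank}(B(\theta),A(\theta)B(\theta),\dots,A(\theta)^{n-1}B(\theta))=n$. Uniform ensemble reachability: a pair $(A,B)\in C_{n,n}(\mathbf{P})\times C_{n,m}(\mathbf{P})$ is uniformly ensemble reachable if for all $f\in C_n(\mathbf{P})$ and $\varepsilon>0$ there exist $T\ge0$ and an input $u$ independent of $\theta$ such that $\sup_{\theta\in\mathbf{P}}\|\varphi(T,\theta)-f(\theta)\|<\varepsilon$, where $\varphi$ is the solution with zero initial state. In continuous time ($\partial_t x(t,\theta)=A(\theta)x(t,\theta)+B(\theta)u(t)$): $T\in[0,\infty)$, $u\in L^1([0,T],\mathbb{C}^m)$, $\varphi(T,\theta)=\int_0^Te^{(T-\tau)A(\theta)}B(\theta)u(\tau)\,d\tau$. In discrete time ($x(t+1,\theta)=A(\theta)x(t,\theta)+B(\theta)u(t)$):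 $T\in\{0,1,2,\dots\}$, $u(k)\in\mathbb{C}^m$, $\varphi(T,\theta)=\sum_{k=0}^{T-1}A(\theta)^{T-1-k}B(\theta)u(k)$. The result applies in either setting. *)

theory Defs
  imports "HOL-Analysis.Analysis"
begin

(* The type class power on vectors is componentwise, so powers with respect to the matrix
   product are defined separately. *)
primrec matrix_power :: "complex ^ 'n ^ 'n \<Rightarrow> nat \<Rightarrow> complex ^ 'n ^ 'n" where
  "matrix_power A 0 = mat 1"
| "matrix_power A (Suc k) = A ** matrix_power A k"

definition matrix_exp :: "complex ^ 'n ^ 'n \<Rightarrow> complex ^ 'n ^ 'n" where
  "matrix_exp A = (\<Sum>k. (1 / fact k :: real) *\<^sub>R matrix_power A k)"

(* The n x (n*m) block matrix (B, AB, ..., A^(n-1) B).  The column with index (k, j) is column j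
   of A^l B, where l < n is the position of k under the bijection to_nat_on UNIV between the
   index type 'n and {..<CARD('n)}.  Thus every block occurs exactly once; the order of the
   blocks has no influence on the rank. *)
definition reachability_matrix ::
    "complex ^ 'n ^ 'n \<Rightarrow> complex ^ 'm ^ 'n \<Rightarrow> complex ^ ('n \<times> 'm) ^ 'n" where
  "reachability_matrix A B =
     (\<chi> i kj. (matrix_power A (to_nat_on (UNIV :: 'n set) (fst kj)) ** B) $ i $ snd kj)"

definition reachable :: "complex ^ 'n ^ 'n \<Rightarrow> complex ^ 'm ^ 'n \<Rightarrow> bool" where
  "reachable A B \<longleftrightarrow> rank (reachability_matrix A B) = CARD('n)"

definition pointwise_reachable ::
    "'p set \<Rightarrow> ('p \<Rightarrow> complex ^ 'n ^ 'n) \<Rightarrow> ('p \<Rightarrow> complex ^ 'm ^ 'n) \<Rightarrow> bool" where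
  "pointwise_reachable P A B \<longleftrightarrow> (\<forall>\<theta>\<in>P. reachable (A \<theta>) (B \<theta>))"

definition state_ct ::
    "complex ^ 'n ^ 'n \<Rightarrow> complex ^ 'm ^ 'n \<Rightarrow> (real \<Rightarrow> complex ^ 'm) \<Rightarrow> real \<Rightarrow> complex ^ 'n" where
  "state_ct A B u T =
     (LINT \<tau>:{0..T}|lebesgue. matrix_exp ((T - \<tau>) *\<^sub>R A) *v (B *v u \<tau>))"

definition state_dt ::
    "complex ^ 'n ^ 'n \<Rightarrow> complex ^ 'm ^ 'n \<Rightarrow> (nat \<Rightarrow> complex ^ 'm) \<Rightarrow> nat \<Rightarrow> complex ^ 'n" where
  "state_dt A B u T = (\<Sum>k<T. matrix_power A (T - 1 - k) *v (B *v u k))"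

(* The two notions below are meant for nonempty compact P and for A, B continuous on P.  Then
   the states at time T depend continuously on the parameter, so that the set whose supremum is
   taken is nonempty and bounded. *)
definition uniformly_ensemble_reachable_ct ::
    "'p::topological_space set \<Rightarrow> ('p \<Rightarrow> complex ^ 'n ^ 'n) \<Rightarrow> ('p \<Rightarrow> complex ^ 'm ^ 'n) \<Rightarrow> bool" where
  "uniformly_ensemble_reachable_ct P A B \<longleftrightarrow>
     (\<forall>f :: 'p \<Rightarrow> complex ^ 'n. continuous_on P f \<longrightarrow>
       (\<forall>\<epsilon>>0. \<exists>T\<ge>0. \<exists>u. u absolutely_integrable_on {0..T} \<and>
         (SUP \<theta>\<in>P. norm (state_ct (A \<theta>) (B \<theta>) u T - f \<theta>)) < \<epsilon>))"

definition uniformly_ensemble_reachable_dt ::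
    "'p::topological_space set \<Rightarrow> ('p \<Rightarrow> complex ^ 'n ^ 'n) \<Rightarrow> ('p \<Rightarrow> complex ^ 'm ^ 'n) \<Rightarrow> bool" where
  "uniformly_ensemble_reachable_dt P A B \<longleftrightarrow>
     (\<forall>f :: 'p \<Rightarrow> complex ^ 'n. continuous_on P f \<longrightarrow>
       (\<forall>\<epsilon>>0. \<exists>T u. (SUP \<theta>\<in>P. norm (state_dt (A \<theta>) (B \<theta>) u T - f \<theta>)) < \<epsilon>))"

end

theory Submission
  imports Defs "HOL-Computational_Algebra.Polynomial"
begin

text \<open>
  Both settings are served by one feedback \<open>K\<close>.  Put \<open>b(\<theta>) = B(\<theta>)v\<close>, which never vanishes,
  and \<open>G = A + BK\<close>.  It suffices to choose a continuous \<open>K\<close> such that, at every \<open>\<theta>\<close>, the vectors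
  \<open>b, Gb, \<dots>, G\<^sup>n\<^sup>-\<^sup>1b\<close> form a basis and \<open>G\<^sup>n b = \<theta> b\<close>.  For then \<open>\<theta>\<^sup>j G\<^sup>i b = G\<^sup>n\<^sup>j\<^sup>+\<^sup>i b\<close>, so a
  combination \<open>\<Sum>\<^sub>i p\<^sub>i(\<theta>) G\<^sup>i b\<close> with polynomials \<open>p\<^sub>i\<close> is \<open>q(G)b\<close> for one polynomial \<open>q\<close> whose
  coefficients do not depend on \<open>\<theta>\<close>.  A continuous target has continuous coordinates in the basis
  \<open>G\<^sup>i b\<close>, and by Weierstrass these are uniform limits of polynomials in \<open>\<theta>\<close>
  (\<open>cyclic_shift_dense\<close>).

  In discrete time \<open>q(G)b\<close> is literally a reachable state.  In continuous time one shows that each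
  \<open>G\<^sup>k b\<close> is a uniform limit of reachable states: a short constant pulse along \<open>v\<close> before the final
  time produces \<open>\<Sum>\<^sub>k h\<^sup>k / (k+1)! G\<^sup>k b\<close>, from which the terms are peeled off one after the other
  (\<open>orbit_in_closure_ct\<close>).

  The feedback is built in two stages.  The first is Heymann's lemma with parameters: at a fixed
  \<open>\<theta>\<close>, inputs \<open>u\<^sub>k\<close> can be chosen so that \<open>x\<^sub>0 = b\<close>, \<open>x\<^sub>k\<^sub>+\<^sub>1 = Ax\<^sub>k + Bu\<^sub>k\<close> gives a basis, since otherwise a
  proper \<open>A\<close>-invariant subspace would contain the image of \<open>B\<close>.  The bad inputs are the zeros of the
  determinant of \<open>(x\<^sub>0, \<dots>, x\<^sub>n\<^sub>-\<^sub>1)\<close>, a polynomial in the inputs.  The complement of its zero set is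
  path connected, because two points in it span a complex line which meets the zero set in finitely
  many points.  This is exactly what is needed to select good inputs that depend continuously on
  \<open>\<theta>\<close> in an interval (\<open>continuous_section_exists\<close>, \<open>ex_continuous_steer\<close>).  With \<open>K\<^sub>1 x\<^sub>k = u\<^sub>k\<close> the
  matrix \<open>F = A + BK\<^sub>1\<close> satisfies \<open>F\<^sup>k b = x\<^sub>k\<close> for \<open>k < n\<close>.  The second stage is Ackermann's formula for the
  single-input pair \<open>(F, b)\<close> and the characteristic polynomial \<open>z\<^sup>n - \<theta>\<close>
  (\<open>cyclic_shift_feedback\<close>).
\<close>

section \<open>Continuous sections over an interval\<close>

lemma glue_sections:
  fixes \<gamma> \<delta> :: "real \<Rightarrow> 'w::topological_space"
  assumes "s \<le> m" "m \<le> t" "continuous_on {s..m} \<gamma>" "continuous_on {m..t} \<delta>" "\<gamma> m = \<delta> m"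
  shows "continuous_on {s..t} (\<lambda>r. if r \<le> m then \<gamma> r else \<delta> r)"
proof -
  have "{s..t} = {s..m} \<union> {m..t}" using assms by auto
  moreover have "continuous_on ({s..m} \<union> {m..t}) (\<lambda>r. if r \<le> m then \<gamma> r else \<delta> r)"
    by (rule continuous_on_cases) (use assms in \<open>auto intro: antisym\<close>)
  ultimately show ?thesis by simp
qed

text \<open>
  Prescribing both ends is what makes sections over adjacent intervals composable.
\<close>

definition section_between ::
    "(real \<times> 'w::topological_space) set \<Rightarrow> real \<Rightarrow> 'w \<Rightarrow> real \<Rightarrow> 'w \<Rightarrow> bool" where
  "section_between S s w t w' \<longleftrightarrow> (\<exists>\<gamma>. continuous_on {s..t} \<gamma> \<and>
     (\<forall>r\<in>{s..t}. (r, \<gamma> r) \<in> S) \<and> \<gamma> s = w \<and> \<gamma> t = w')"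

lemma section_between_trans:
  assumes "section_between S s w m w'" "section_between S m w' t w''" "s \<le> m" "m \<le> t"
  shows "section_between S s w t w''"
proof -
  obtain \<gamma> \<delta> where
    \<gamma>: "continuous_on {s..m} \<gamma>" "\<forall>r\<in>{s..m}. (r, \<gamma> r) \<in> S" "\<gamma> s = w" "\<gamma> m = w'" and
    \<delta>: "continuous_on {m..t} \<delta>" "\<forall>r\<in>{m..t}. (r, \<delta> r) \<in> S" "\<delta> m = w'" "\<delta> t = w''"
    using assms unfolding section_between_def by blast
  show ?thesis unfolding section_between_def
  proof (intro exI conjI)
    show "continuous_on {s..t} (\<lambda>r. if r \<le> m then \<gamma> r else \<delta> r)"
      using assms \<gamma> \<delta> by (intro glue_sections) auto
  qed (use assms \<gamma> \<delta> in auto)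
qed

text \<open>
  Reversing the parameter axis exchanges the two ends of a section, so that only left ends have to
  be treated below.
\<close>

lemma section_between_reflect:
  assumes "section_between ((\<lambda>(r, w). (- r, w)) ` S) (- t) w' (- s) w"
  shows "section_between S s w t w'"
proof -
  obtain \<gamma> where \<gamma>: "continuous_on {- t..- s} \<gamma>"
      "\<forall>r\<in>{- t..- s}. (r, \<gamma> r) \<in> (\<lambda>(r, w). (- r, w)) ` S" "\<gamma> (- t) = w'" "\<gamma> (- s) = w"
    using assms unfolding section_between_def by blast
  have "continuous_on {s..t} (\<lambda>r. \<gamma> (- r))"
    by (rule continuous_on_compose2[OF \<gamma>(1)]) (auto intro: continuous_intros)
  moreover have "(r, \<gamma> (- r)) \<in> S" if "r \<in> {s..t}" for r
    using \<gamma>(2)[rule_format, of "- r"] that by auto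
  ultimately show ?thesis unfolding section_between_def using \<gamma> by auto
qed

text \<open>
  A path in the fibre over the left end from \<open>w\<close> to \<open>w'\<close> stays inside the open set when the
  parameter is moved slightly, by the tube lemma.  It can therefore be run through within a short
  initial interval, after which the section stays at \<open>w'\<close>.
\<close>

lemma section_between_fibre_path:
  fixes S :: "(real \<times> 'w::topological_space) set"
  assumes "open S" "s < t" and pc: "path_connected {w. (s, w) \<in> S}"
    and w: "(s, w) \<in> S" and const: "\<And>r. r \<in> {s..t} \<Longrightarrow> (r, w') \<in> S"
  shows "section_between S s w t w'"
proof -
  have "(s, w') \<in> S" using const assms by auto
  then obtain p where p: "path p" "path_image p \<subseteq> {w. (s, w) \<in> S}" "p 0 = w" "p 1 = w'"
    using pc w unfolding path_connected_def pathstart_def pathfinish_def by blast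
  have "{s} \<times> path_image p \<subseteq> S" using p by auto
  then obtain X where X: "s \<in> X" "open X" "X \<times> path_image p \<subseteq> S"
    using Elementary_Topology.tube_lemma[OF compact_path_image[OF p(1)] \<open>open S\<close>] by metis
  then obtain e where e: "e > 0" "\<And>r. dist r s < e \<Longrightarrow> r \<in> X"
    unfolding open_dist by blast
  define \<eta> where "\<eta> = min (e / 2) (t - s)"
  have \<eta>: "\<eta> > 0" "\<eta> < e" "\<eta> \<le> t - s" using e assms by (auto simp: \<eta>_def min_def)
  \<comment> \<open>runs through \<open>{0..1}\<close> on \<open>{s..s + \<eta>}\<close> and then rests at \<open>1\<close>\<close>
  define \<phi> where "\<phi> r = min 1 ((r - s) / \<eta>)" for r
  have \<phi>: "\<phi> r \<in> {0..1}" if "r \<in> {s..t}" for r using that \<eta> by (auto simp: \<phi>_def)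
  have "continuous_on {s..t} (\<lambda>r. p (\<phi> r))"
    by (rule continuous_on_compose2[OF p(1)[unfolded path_def]])
       (use \<phi> \<eta> in \<open>auto simp: \<phi>_def intro!: continuous_intros\<close>)
  moreover have "(r, p (\<phi> r)) \<in> S" if r: "r \<in> {s..t}" for r
  proof (cases "r \<le> s + \<eta>")
    case True
    then have "r \<in> X" using e(2) r \<eta> by (auto simp: dist_real_def)
    moreover have "p (\<phi> r) \<in> path_image p" using \<phi>[OF r] by (auto simp: path_image_def)
    ultimately show ?thesis using X by auto
  next
    case False
    then have "\<phi> r = 1" using \<eta> by (auto simp: \<phi>_def min_def field_simps)
    then show ?thesis using const r p by auto
  qed
  moreover have "p (\<phi> s) = w" "p (\<phi> t) = w'"
    using p \<eta> by (auto simp: \<phi>_def min_def field_simps)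
  ultimately show ?thesis unfolding section_between_def by blast
qed

text \<open>
  Near each parameter a constant section exists, as the set is open; by path connectedness of the
  fibres its two ends can be moved to any prescribed values.  Hence arbitrary end values can be joined
  over short intervals, and this property is inherited by unions of adjacent intervals.
\<close>

lemma continuous_section_exists:
  fixes S :: "(real \<times> 'w::topological_space) set"
  assumes "a \<le> b" "open S"
    and pc: "\<And>t. t \<in> {a..b} \<Longrightarrow> path_connected {w. (t, w) \<in> S}"
    and ne: "\<And>t. t \<in> {a..b} \<Longrightarrow> \<exists>w. (t, w) \<in> S"
  obtains \<gamma> where "continuous_on {a..b} \<gamma>" "\<And>t. t \<in> {a..b} \<Longrightarrow> (t, \<gamma> t) \<in> S"
proof -
  define P where "P s t \<longleftrightarrow> (s < t \<and> a \<le> s \<and> t \<le> b \<longrightarrow>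
    (\<forall>w w'. (s, w) \<in> S \<longrightarrow> (t, w') \<in> S \<longrightarrow> section_between S s w t w'))" for s t
  have "P a b" using \<open>a \<le> b\<close>
  proof (induction rule: Bolzano)
    case (trans s m t)
    consider "s = m" | "m = t" | "s < m" "m < t" using trans by linarith
    then show ?case
    proof cases
      case 3
      show ?thesis unfolding P_def
      proof (intro impI allI)
        fix w w' assume *: "s < t \<and> a \<le> s \<and> t \<le> b" "(s, w) \<in> S" "(t, w') \<in> S"
        then obtain v where "(m, v) \<in> S" using ne[of m] 3 by auto
        then show "section_between S s w t w'"
          using trans(1,2) 3 * unfolding P_def
          by (intro section_between_trans[of S s w m v t w']) simp_all
      qed
    qed (use trans in auto)
  next
    case (local x)
    then obtain w0 where w0: "(x, w0) \<in> S" using ne[of x] by auto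
    have "open ((\<lambda>r. (r, w0)) -` S)"
      by (intro open_vimage \<open>open S\<close>) (auto intro: continuous_intros)
    then obtain d where d: "d > 0" "\<And>r. dist r x < d \<Longrightarrow> (r, w0) \<in> S"
      using w0 unfolding open_dist by (metis vimageE vimageI2)
    show ?case
    proof (intro exI conjI allI impI)
      show "d > 0" by fact
      fix s t assume st: "s \<le> x \<and> x \<le> t \<and> t - s < d"
      have const: "(r, w0) \<in> S" if "r \<in> {s..t}" for r
        using that st by (intro d) (auto simp: dist_real_def)
      show "P s t" unfolding P_def
      proof (intro impI allI)
        fix w w' assume *: "s < t \<and> a \<le> s \<and> t \<le> b" "(s, w) \<in> S" "(t, w') \<in> S"
        \<comment> \<open>go from \<open>w\<close> to the constant \<open>w0\<close> in the left half, and on to \<open>w'\<close> in the right half\<close>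
        define m where "m = (s + t) / 2"
        have m: "s < m" "m < t" using * by (auto simp: m_def)
        have "section_between S s w m w0"
          using * m const by (intro section_between_fibre_path \<open>open S\<close> pc) auto
        moreover have "section_between S m w0 t w'"
        proof (rule section_between_reflect, rule section_between_fibre_path)
          have "(\<lambda>(r, w). (- r, w)) ` S = (\<lambda>(r, w). (- r, w)) -` S"
            by force
          moreover have "open ((\<lambda>(r, w). (- r, w)) -` S)"
            by (intro open_vimage \<open>open S\<close>) (auto simp: case_prod_beta intro!: continuous_intros)
          ultimately show "open ((\<lambda>(r, w). (- r, w)) ` S)" by simp
          have "{w. (- t, w) \<in> (\<lambda>(r, w). (- r, w)) ` S} = {w. (t, w) \<in> S}" by force
          then show "path_connected {w. (- t, w) \<in> (\<lambda>(r, w). (- r, w)) ` S}"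
            using pc[of t] * by auto
          show "(- t, w') \<in> (\<lambda>(r, w). (- r, w)) ` S" using * by force
          show "(r, w0) \<in> (\<lambda>(r, w). (- r, w)) ` S" if "r \<in> {- t..- m}" for r
            using const[of "- r"] that m by (force intro: image_eqI[of _ _ "(- r, w0)"])
        qed (use m in auto)
        ultimately show "section_between S s w t w'"
          by (rule section_between_trans) (use m in simp_all)
      qed
    qed
  qed
  obtain w w' where w: "(a, w) \<in> S" "(b, w') \<in> S" using ne[of a] ne[of b] \<open>a \<le> b\<close> by auto
  show thesis
  proof (cases "a = b")
    case True
    then show thesis using that[of "\<lambda>_. w"] w by auto
  next
    case False
    then have "section_between S a w b w'" using \<open>P a b\<close> w \<open>a \<le> b\<close> unfolding P_def by auto
    then show thesis using that unfolding section_between_def by blast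
  qed
qed

section \<open>Heymann's lemma at a fixed parameter\<close>

text \<open>
  Only the restrictions to complex lines of the polynomials in many variables below matter, and these
  are polynomial functions of one variable.
\<close>

definition polyfun :: "(complex \<Rightarrow> complex) \<Rightarrow> bool" where
  "polyfun f \<longleftrightarrow> (\<exists>p. f = poly p)"

lemma polyfun_const: "polyfun (\<lambda>_. c)"
  unfolding polyfun_def by (rule exI[of _ "[:c:]"]) auto

lemma polyfun_ident: "polyfun (\<lambda>z. z)"
  unfolding polyfun_def by (rule exI[of _ "[:0, 1:]"]) auto

lemma polyfun_add: "polyfun f \<Longrightarrow> polyfun g \<Longrightarrow> polyfun (\<lambda>z. f z + g z)"
  unfolding polyfun_def by (auto simp: fun_eq_iff simp flip: poly_add)

lemma polyfun_mult: "polyfun f \<Longrightarrow> polyfun g \<Longrightarrow> polyfun (\<lambda>z. f z * g z)"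
  unfolding polyfun_def by (auto simp: fun_eq_iff simp flip: poly_mult)

lemma polyfun_sum: "(\<And>i. i \<in> I \<Longrightarrow> polyfun (f i)) \<Longrightarrow> polyfun (\<lambda>z. \<Sum>i\<in>I. f i z)"
  by (induction I rule: infinite_finite_induct) (auto intro: polyfun_const polyfun_add)

lemma polyfun_prod: "(\<And>i. i \<in> I \<Longrightarrow> polyfun (f i)) \<Longrightarrow> polyfun (\<lambda>z. \<Prod>i\<in>I. f i z)"
  by (induction I rule: infinite_finite_induct) (auto intro: polyfun_const polyfun_mult)

lemmas polyfun_intros = polyfun_const polyfun_ident polyfun_add polyfun_mult polyfun_sum polyfun_prod

lemma polyfun_mult_vec:
  "(\<And>i. polyfun (\<lambda>z. f z $ i)) \<Longrightarrow> polyfun (\<lambda>z. (A *v f z) $ j)"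
  by (auto simp: matrix_vector_mult_def intro!: polyfun_intros)

lemma polyfun_det: "(\<And>i j. polyfun (\<lambda>z. M z $ i $ j)) \<Longrightarrow> polyfun (\<lambda>z. det (M z))"
  unfolding det_def by (intro polyfun_intros) auto

definition complex_line ::
    "complex ^ 'm ^ 'n \<Rightarrow> complex ^ 'm ^ 'n \<Rightarrow> complex \<Rightarrow> complex ^ 'm ^ 'n" where
  "complex_line u w z = (\<chi> i j. u $ i $ j + z * (w $ i $ j - u $ i $ j))"

text \<open>
  The complex line through two points at which \<open>Q\<close> does not vanish contains only finitely many zeros
  of \<open>Q\<close>, and the plane minus a finite set is path connected.
\<close>

lemma path_connected_nonzero_set:
  fixes Q :: "complex ^ 'm ^ 'n \<Rightarrow> complex"
  assumes poly: "\<And>u w. polyfun (\<lambda>z. Q (complex_line u w z))"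
  shows "path_connected {u. Q u \<noteq> 0}"
  unfolding path_connected_component
proof (intro ballI)
  fix u w assume u: "u \<in> {u. Q u \<noteq> 0}" and w: "w \<in> {u. Q u \<noteq> 0}"
  obtain p where p: "(\<lambda>z. Q (complex_line u w z)) = poly p"
    using poly unfolding polyfun_def by blast
  have ends: "complex_line u w 0 = u" "complex_line u w 1 = w"
    by (simp_all add: complex_line_def vec_eq_iff)
  have "p \<noteq> 0" using u p ends by (metis (mono_tags) mem_Collect_eq poly_0)
  then have "countable {z. poly p z = 0}" by (intro countable_finite poly_roots_finite)
  then have "path_connected (- {z. poly p z = 0})"
    by (intro path_connected_complement_countable) auto
  moreover have "continuous_on T (complex_line u w)" for T
    unfolding complex_line_def by (intro continuous_intros)
  ultimately have pc: "path_connected (complex_line u w ` (- {z. poly p z = 0}))"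
    by (intro path_connected_continuous_image)
  have sub: "complex_line u w ` (- {z. poly p z = 0}) \<subseteq> {u. Q u \<noteq> 0}"
    using p by (auto simp: fun_eq_iff)
  have "0 \<in> - {z. poly p z = 0}" "1 \<in> - {z. poly p z = 0}"
    using u w ends p[THEN fun_cong] by (metis (mono_tags) ComplI mem_Collect_eq)+
  then have "u \<in> complex_line u w ` (- {z. poly p z = 0})"
    "w \<in> complex_line u w ` (- {z. poly p z = 0})" using ends by (metis imageI)+
  then have "path_component (complex_line u w ` (- {z. poly p z = 0})) u w"
    using pc unfolding path_connected_component by blast
  then show "path_component {u. Q u \<noteq> 0} u w"
    using sub path_component_of_subset by blast
qed

text \<open>
  Orbits are sequences indexed by \<open>nat\<close>, while matrix columns are indexed by a finite type.  The
  bijection between the type and an initial segment is the one that orders the blocks of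
  \<^const>\<open>reachability_matrix\<close>.
\<close>

abbreviation (input) pos :: "'n::finite \<Rightarrow> nat" where "pos \<equiv> to_nat_on UNIV"
abbreviation (input) idx :: "nat \<Rightarrow> 'n::finite" where "idx \<equiv> from_nat_into UNIV"

lemma pos_less: "pos (i :: 'n::finite) < CARD('n)"
  using to_nat_on_finite[of "UNIV :: 'n set"] by (auto simp: bij_betw_def)

lemma idx_pos [simp]: "idx (pos i) = (i :: 'n::finite)"
  by (simp add: from_nat_into_to_nat_on countable_finite)

lemma pos_idx: "k < CARD('n) \<Longrightarrow> pos (idx k :: 'n::finite) = k"
  using to_nat_on_finite[of "UNIV :: 'n set"]
  by (intro to_nat_on_from_nat_into) (auto simp: bij_betw_def)

lemma sum_pos: "(\<Sum>i\<in>(UNIV :: 'n::finite set). f (pos i)) = (\<Sum>k<CARD('n). f k)"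
  using to_nat_on_finite[of "UNIV :: 'n set"] by (intro sum.reindex_bij_betw) auto

definition col_matrix :: "(nat \<Rightarrow> complex ^ 'n) \<Rightarrow> complex ^ 'n ^ 'n" where
  "col_matrix x = (\<chi> i j. x (pos j) $ i)"

lemma col_matrix_mult: "col_matrix x *v c = (\<Sum>j\<in>UNIV. c $ j *s x (pos j))"
  by (auto simp: col_matrix_def matrix_vector_mult_def vec_eq_iff mult.commute intro!: sum.cong)

lemma mult_axis_eq_column: "A *v axis j 1 = column j (A :: 'a::field ^ 'k ^ 'n)"
  by (simp add: matrix_vector_mult_def vec_eq_iff axis_def column_def if_distrib cong: if_cong)

lemma col_matrix_axis: "k < CARD('n) \<Longrightarrow> col_matrix x *v axis (idx k) 1 = (x k :: complex ^ 'n)"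
  by (simp add: mult_axis_eq_column col_matrix_def column_def pos_idx)

text \<open>
  The inputs are the rows of a matrix, so that the space of input sequences is a vector space with a
  topology.
\<close>

primrec steer ::
    "complex ^ 'n ^ 'n \<Rightarrow> complex ^ 'm ^ 'n \<Rightarrow> complex ^ 'n \<Rightarrow> complex ^ 'm ^ 'n \<Rightarrow> nat \<Rightarrow> complex ^ 'n"
  where
    "steer A B x u 0 = x"
  | "steer A B x u (Suc k) = A *v steer A B x u k + B *v (u $ idx k)"

lemma steer_cong: "(\<And>j. j < k \<Longrightarrow> u $ idx j = u' $ idx j) \<Longrightarrow> steer A B x u k = steer A B x u' k"
  by (induction k) auto

lemma polyfun_steer: "polyfun (\<lambda>z. steer A B x (complex_line u w z) k $ i)"
proof (induction k arbitrary: i)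
  case 0
  then show ?case by (simp add: polyfun_const)
next
  case (Suc k)
  have "polyfun (\<lambda>z. (B *v (complex_line u w z $ idx k)) $ i)"
    by (rule polyfun_mult_vec) (auto simp: complex_line_def intro!: polyfun_intros)
  then show ?case by (auto intro!: polyfun_add polyfun_mult_vec Suc)
qed

lemma independent_family_coeffs_zero:
  fixes g :: "'i::finite \<Rightarrow> 'a::field ^ 'n"
  assumes "inj g" "vec.independent (range g)" "(\<Sum>i\<in>UNIV. c i *s g i) = 0"
  shows "c i = 0"
proof -
  have "(\<Sum>y\<in>range g. c (inv g y) *s y) = (\<Sum>i\<in>UNIV. c i *s g i)"
    using assms(1) by (subst sum.reindex) auto
  then have "c (inv g (g i)) = 0"
    using vec.independentD[OF assms(2), of "range g" "\<lambda>y. c (inv g y)" "g i"] assms(3) by auto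
  then show ?thesis using assms(1) by simp
qed

text \<open>
  The rank is the dimension of the row space, so full rank says that the rows are independent.
\<close>

lemma full_rank_right_inverse:
  fixes R :: "'a::field ^ 'k ^ 'n"
  assumes "rank R = CARD('n)"
  shows "\<exists>R'. R ** R' = mat 1"
  unfolding matrix_right_invertible_independent_rows
proof (intro allI impI)
  fix c and i :: 'n assume c: "(\<Sum>i\<in>UNIV. c i *s row i R) = 0"
  have rows: "rows R = range (\<lambda>i. row i R)" by (auto simp: rows_def)
  have dim: "vec.dim (rows R) = CARD('n)" using assms by (simp add: row_rank_def_gen)
  have "card (rows R) \<le> CARD('n)" unfolding rows by (rule card_image_le) simp
  moreover have "vec.dim (rows R) \<le> card (rows R)"
    by (rule vec.dim_le_card') (simp add: rows)
  ultimately have card: "card (rows R) = CARD('n)" using dim by simp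
  then have "inj (\<lambda>i. row i R)" unfolding rows by (intro eq_card_imp_inj_on) auto
  moreover have "vec.independent (rows R)"
    by (rule vec.card_le_dim_spanning[of _ "vec.span (rows R)"])
       (simp_all add: vec.span_superset card dim, simp add: rows)
  ultimately show "c i = 0" using independent_family_coeffs_zero c unfolding rows by blast
qed

text \<open>
  Such a subspace contains every column of the reachability matrix, and these columns span the whole
  space.
\<close>

lemma reachable_invariant_subspace:
  fixes A :: "complex ^ 'n ^ 'n"
  assumes "reachable A B" and S: "vec.subspace S"
    and inv: "\<And>y. y \<in> S \<Longrightarrow> A *v y \<in> S" and im: "\<And>w. B *v w \<in> S"
  shows "S = UNIV"
proof -
  obtain R' where R': "reachability_matrix A B ** R' = mat 1"
    using assms full_rank_right_inverse unfolding reachable_def by blast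
  have power: "matrix_power A k *v (B *v w) \<in> S" for k w
    by (induction k) (auto simp: im inv simp flip: matrix_vector_mul_assoc)
  have "column kj (reachability_matrix A B) \<in> S" for kj
  proof -
    have "column kj (reachability_matrix A B) =
        column (snd kj) (matrix_power A (pos (fst kj)) ** B)"
      by (simp add: column_def reachability_matrix_def)
    also have "\<dots> = matrix_power A (pos (fst kj)) *v (B *v axis (snd kj) 1)"
      by (metis matrix_vector_mul_assoc mult_axis_eq_column)
    finally show ?thesis using power by simp
  qed
  then have "reachability_matrix A B *v y \<in> S" for y
    unfolding matrix_mult_sum by (intro vec.subspace_sum vec.subspace_scale S)
  moreover have "reachability_matrix A B *v (R' *v y) = y" for y
    by (simp add: matrix_vector_mul_assoc R')
  ultimately show ?thesis by (metis UNIV_eq_I)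
qed

text \<open>
  Heymann's lemma at a fixed parameter.  If no input led out of the span \<open>S\<close> of the states reached so
  far, then the zero input would give \<open>Ax\<^sub>k \<in> S\<close>, hence \<open>S\<close> would contain the image of \<open>B\<close>; as every
  earlier \<open>Ax\<^sub>j\<close> is \<open>x\<^sub>j\<^sub>+\<^sub>1 - Bu\<^sub>j\<close>, the space \<open>S\<close> would also be \<open>A\<close>-invariant, and so it would be
  everything.
\<close>

lemma ex_steer_independent:
  fixes A :: "complex ^ 'n ^ 'n" and B :: "complex ^ 'm ^ 'n"
  assumes reach: "reachable A B" and "x \<noteq> 0" and "k < CARD('n)"
  shows "\<exists>u. inj_on (steer A B x u) {..k} \<and> vec.independent (steer A B x u ` {..k})"
  using \<open>k < CARD('n)\<close>
proof (induction k)
  case 0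
  then show ?case using \<open>x \<noteq> 0\<close> by simp
next
  case (Suc k)
  then obtain u where u: "inj_on (steer A B x u) {..k}" "vec.independent (steer A B x u ` {..k})"
    by auto
  define S where "S = vec.span (steer A B x u ` {..k})"
  have S: "vec.subspace S" by (simp add: S_def)
  have base: "steer A B x u j \<in> S" if "j \<le> k" for j
    using that by (auto simp: S_def intro!: vec.span_base)
  have "\<exists>w. A *v steer A B x u k + B *v w \<notin> S"
  proof (rule ccontr)
    assume "\<not> ?thesis"
    then have next_in: "A *v steer A B x u k + B *v w \<in> S" for w by blast
    have Ak: "A *v steer A B x u k \<in> S" using next_in[of 0] by simp
    have im: "B *v w \<in> S" for w
      using vec.subspace_diff[OF S next_in[of w] Ak] by simp
    have gen: "A *v steer A B x u j \<in> S" if "j \<le> k" for j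
    proof (cases "j = k")
      case False
      then have "steer A B x u (Suc j) - B *v (u $ idx j) \<in> S"
        using that by (intro vec.subspace_diff S base im) auto
      then show ?thesis by simp
    qed (use Ak in auto)
    have "A *v y \<in> S" if "y \<in> S" for y
      using that[unfolded S_def]
    proof (rule vec.span_induct)
      show "vec.subspace {y. A *v y \<in> S}"
        using S unfolding vec.subspace_def
        by (auto simp: matrix_vector_right_distrib vec.scale)
    qed (use gen in auto)
    then have "S = UNIV" using reachable_invariant_subspace[OF reach S] im by blast
    then have "CARD('n) = vec.dim S" by (simp only: vec_dim_card)
    also have "\<dots> \<le> card (steer A B x u ` {..k})"
      unfolding S_def by (subst vec.dim_span) (rule vec.dim_le_card', simp)
    also have "\<dots> \<le> Suc k"
      using card_image_le[of "{..k}" "steer A B x u"] by simp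
    finally show False using Suc.prems by simp
  qed
  then obtain w where w: "A *v steer A B x u k + B *v w \<notin> S" by blast
  \<comment> \<open>changing input \<open>k\<close> leaves the states up to index \<open>k\<close> as they are\<close>
  define u' where "u' = (\<chi> i. if i = idx k then w else u $ i)"
  have old: "steer A B x u' j = steer A B x u j" if "j \<le> k" for j
  proof (rule steer_cong)
    fix l assume "l < j"
    then have "l < k" "k < CARD('n)" using Suc.prems that by auto
    then have "pos (idx l :: 'n) \<noteq> pos (idx k :: 'n)" by (simp add: pos_idx)
    then have "(idx l :: 'n) \<noteq> idx k" by metis
    then show "u' $ idx l = u $ idx l" by (simp add: u'_def)
  qed
  have new: "steer A B x u' (Suc k) = A *v steer A B x u k + B *v w"
    using old[of k] by (simp add: u'_def)
  have im: "steer A B x u' ` {..k} = steer A B x u ` {..k}" by (auto simp: old)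
  have "inj_on (steer A B x u') {..k}" using u(1) by (auto simp only: inj_on_def old atMost_iff)
  moreover have notin: "steer A B x u' (Suc k) \<notin> vec.span (steer A B x u' ` {..k})"
    using w unfolding new im S_def .
  moreover have "steer A B x u' (Suc k) \<notin> steer A B x u' ` {..k}"
    using notin by (rule contrapos_nn) (rule vec.span_base)
  moreover have "{..k} - {Suc k} = {..k}" by auto
  ultimately have "inj_on (steer A B x u') (insert (Suc k) {..k})"
    by (simp only: inj_on_insert simp_thms)
  moreover have "vec.independent (insert (steer A B x u' (Suc k)) (steer A B x u' ` {..k}))"
    using notin u(2) unfolding im by (rule vec.independent_insertI)
  ultimately show ?case unfolding atMost_Suc image_insert by blast
qed

lemma det_nonzero_iff_injective:
  fixes M :: "complex ^ 'n ^ 'n"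
  shows "det M \<noteq> 0 \<longleftrightarrow> (\<forall>c. M *v c = 0 \<longrightarrow> c = 0)"
  using invertible_det_nz[of M] matrix_left_invertible_ker[of M]
  by (simp add: invertible_left_inverse)

lemma ex_steer_det:
  fixes A :: "complex ^ 'n ^ 'n" and B :: "complex ^ 'm ^ 'n"
  assumes "reachable A B" "x \<noteq> 0"
  shows "\<exists>u. det (col_matrix (steer A B x u)) \<noteq> 0"
proof -
  obtain u where u: "inj_on (steer A B x u) {..CARD('n) - 1}"
      "vec.independent (steer A B x u ` {..CARD('n) - 1})"
    using ex_steer_independent[OF assms, of "CARD('n) - 1"] by auto
  have "x \<le> CARD('n) - 1 \<longleftrightarrow> x < CARD('n)" for x :: nat
    using zero_less_card_finite[where 'a='n] by linarith
  then have set: "{..CARD('n) - 1} = range (pos :: 'n \<Rightarrow> nat)"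
    using to_nat_on_finite[of "UNIV :: 'n set"] by (auto simp: bij_betw_def)
  have "inj (\<lambda>j. steer A B x u (pos (j :: 'n)))"
    using u(1) unfolding set by (auto simp: inj_def inj_on_def)
  moreover have "vec.independent (range (\<lambda>j. steer A B x u (pos (j :: 'n))))"
    using u(2) unfolding set by (simp add: image_image)
  ultimately have "c = 0" if "col_matrix (steer A B x u) *v c = 0" for c
    using independent_family_coeffs_zero[of "\<lambda>j. steer A B x u (pos (j :: 'n))" "\<lambda>j. c $ j"] that
    by (simp add: col_matrix_mult vec_eq_iff)
  then show ?thesis unfolding det_nonzero_iff_injective by blast
qed

section \<open>A continuous feedback with cyclic shift structure\<close>

lemma continuous_on_mult_vec:
  fixes A :: "'a::topological_space \<Rightarrow> complex ^ 'k ^ 'n"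
  assumes "continuous_on S A" "continuous_on S x"
  shows "continuous_on S (\<lambda>t. A t *v x t)"
  unfolding matrix_vector_mult_def by (intro continuous_intros assms)

lemma continuous_on_matrix_mult:
  fixes A :: "'a::topological_space \<Rightarrow> complex ^ 'k ^ 'n" and B :: "'a \<Rightarrow> complex ^ 'l ^ 'k"
  assumes "continuous_on S A" "continuous_on S B"
  shows "continuous_on S (\<lambda>t. A t ** B t)"
  unfolding matrix_matrix_mult_def by (intro continuous_intros assms)

lemma scaleR_matrix_mult_vec: "(r *\<^sub>R A) *v y = r *\<^sub>R (A *v y)" for A :: "complex ^ 'k ^ 'n"
  by (simp add: matrix_vector_mult_def vec_eq_iff scaleR_sum_right)

lemma scaleR_eq_smult: "r *\<^sub>R y = complex_of_real r *s y" for y :: "complex ^ 'n"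
  by (simp add: vec_eq_iff scaleR_conv_of_real[where 'a=complex])

lemma continuous_on_det:
  fixes A :: "'a::topological_space \<Rightarrow> complex ^ 'n ^ 'n"
  assumes "continuous_on S A"
  shows "continuous_on S (\<lambda>t. det (A t))"
  unfolding det_def by (intro continuous_intros assms)

lemma continuous_on_matrix_power:
  fixes A :: "'a::topological_space \<Rightarrow> complex ^ 'n ^ 'n"
  assumes "continuous_on S A"
  shows "continuous_on S (\<lambda>t. matrix_power (A t) k)"
  by (induction k) (auto intro!: continuous_on_matrix_mult assms)

lemma continuous_on_col_matrix:
  fixes x :: "'a::topological_space \<Rightarrow> nat \<Rightarrow> complex ^ 'n"
  assumes "\<And>k. continuous_on S (\<lambda>t. x t k)"
  shows "continuous_on S (\<lambda>t. col_matrix (x t))"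
  unfolding col_matrix_def by (intro continuous_intros assms)

lemma continuous_on_steer:
  assumes "continuous_on S A" "continuous_on S B" "continuous_on S x" "continuous_on S u"
  shows "continuous_on S (\<lambda>t. steer (A t) (B t) (x t) (u t) k)"
  by (induction k) (auto intro!: continuous_on_mult_vec continuous_intros assms)

text \<open>
  Cramer's rule expresses the entries of the inverse as quotients of determinants.
\<close>

lemma continuous_inverse_matrix:
  fixes M :: "'a::topological_space \<Rightarrow> complex ^ 'n ^ 'n"
  assumes M: "continuous_on S M" and det: "\<And>t. t \<in> S \<Longrightarrow> det (M t) \<noteq> 0"
  obtains N where "continuous_on S N" "\<And>t. t \<in> S \<Longrightarrow> M t ** N t = mat 1"
    "\<And>t. t \<in> S \<Longrightarrow> N t ** M t = mat 1"
proof -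
  define N :: "'a \<Rightarrow> complex ^ 'n ^ 'n" where
    "N t = (\<chi> k l. det (\<chi> i j. if j = k then axis l 1 $ i else M t $ i $ j) / det (M t))" for t
  have "continuous_on S N"
    unfolding N_def
  proof (intro continuous_intros continuous_on_det M)
    fix k l i j
    show "continuous_on S (\<lambda>t. if j = k then axis l 1 $ i else M t $ i $ j)"
      by (cases "j = k") (auto intro!: continuous_intros M)
  qed (use det in auto)
  moreover have right: "M t ** N t = mat 1" if "t \<in> S" for t
  proof -
    have "(M t ** N t) *v axis l 1 = axis l 1" for l
    proof -
      have "N t *v axis l 1 = (\<chi> k. N t $ k $ l)"
        unfolding mult_axis_eq_column column_def ..
      then have "M t *v (N t *v axis l 1) = axis l 1"
        by (subst cramer[OF det[OF that]]) (simp add: N_def)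
      then show ?thesis by (simp add: matrix_vector_mul_assoc)
    qed
    then have "column l (M t ** N t) = column l (mat 1)" for l
      by (metis mult_axis_eq_column matrix_vector_mul_lid)
    then show ?thesis by (simp add: column_def vec_eq_iff)
  qed
  ultimately show thesis using that matrix_left_right_inverse by blast
qed

text \<open>
  Heymann's lemma with parameters.  The coefficients are extended constantly beyond the ends of the
  interval, so that the admissible pairs of parameter and inputs form an open set.
\<close>

lemma ex_continuous_steer:
  fixes A :: "real \<Rightarrow> complex ^ 'n ^ 'n" and B :: "real \<Rightarrow> complex ^ 'm ^ 'n"
  assumes "a \<le> b" and A: "continuous_on {a..b} A" and B: "continuous_on {a..b} B"
    and x: "continuous_on {a..b} x" and "\<And>t. t \<in> {a..b} \<Longrightarrow> x t \<noteq> 0"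
    and "pointwise_reachable {a..b} A B"
  obtains u where "continuous_on {a..b} u"
    "\<And>t. t \<in> {a..b} \<Longrightarrow> det (col_matrix (steer (A t) (B t) (x t) (u t))) \<noteq> 0"
proof -
  \<comment> \<open>the retraction of the line onto the interval\<close>
  define \<rho> where "\<rho> t = max a (min b t)" for t :: real
  have \<rho>: "\<rho> t \<in> {a..b}" "t \<in> {a..b} \<Longrightarrow> \<rho> t = t" for t
    using \<open>a \<le> b\<close> by (auto simp: \<rho>_def)
  define Q where "Q t u = det (col_matrix (steer (A (\<rho> t)) (B (\<rho> t)) (x (\<rho> t)) u))" for t u
  define S where "S = {p. Q (fst p) (snd p) \<noteq> 0}"
  have clamp: "continuous_on UNIV (\<lambda>p. f (\<rho> (fst p)))" if "continuous_on {a..b} f"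
    for f :: "real \<Rightarrow> 'x::topological_space"
    by (rule continuous_on_compose2[OF that]) (use \<rho> in \<open>auto simp: \<rho>_def intro!: continuous_intros\<close>)
  have "continuous_on UNIV (\<lambda>p. Q (fst p) (snd p))"
    unfolding Q_def
    by (intro continuous_on_det continuous_on_col_matrix continuous_on_steer clamp A B x)
       (intro continuous_intros)
  then have "open S" unfolding S_def by (intro open_Collect_neq continuous_intros)
  moreover have "path_connected {u. (t, u) \<in> S}" for t
    unfolding S_def Q_def fst_conv snd_conv mem_Collect_eq
    by (rule path_connected_nonzero_set)
       (auto intro!: polyfun_det polyfun_steer simp: col_matrix_def)
  moreover have "\<exists>u. (t, u) \<in> S" if "t \<in> {a..b}" for t
    using ex_steer_det[of "A t" "B t" "x t"] assms that \<rho>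
    by (auto simp: S_def Q_def pointwise_reachable_def)
  ultimately obtain u where "continuous_on {a..b} u" "\<And>t. t \<in> {a..b} \<Longrightarrow> (t, u t) \<in> S"
    using continuous_section_exists[OF \<open>a \<le> b\<close>] by metis
  then show thesis using that[of u] \<rho> by (auto simp: S_def Q_def)
qed

lemma matrix_power_Suc_right: "matrix_power A (Suc k) = matrix_power A k ** A"
  by (induction k) (simp_all add: matrix_mul_assoc)

lemma matrix_power_Suc_vec: "matrix_power A (Suc k) *v y = matrix_power A k *v (A *v y)"
  by (simp only: matrix_power_Suc_right matrix_vector_mul_assoc)

lemma matrix_power_add_vec: "matrix_power A (j + k) *v y = matrix_power A j *v (matrix_power A k *v y)"
  by (induction j) (simp_all flip: matrix_vector_mul_assoc)

text \<open>
  Ackermann's formula.  The functional \<open>l\<close>, the last row of \<open>N\<close>, vanishes on \<open>F\<^sup>k b\<close> for \<open>k < n - 1\<close>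
  and is \<open>1\<close> on \<open>F\<^sup>n\<^sup>-\<^sup>1 b\<close>.  Adding feedback along \<open>b\<close> therefore does not change \<open>l \<circ> F\<^sup>k\<close> for \<open>k < n\<close>,
  and the gain \<open>y \<mapsto> l (\<theta>y - F\<^sup>n y)\<close> is made to give \<open>l (G\<^sup>n y) = \<theta> l y\<close>.  Since the
  numbers \<open>l (G\<^sup>j G\<^sup>k b)\<close> form an anti-triangular array with units on the antidiagonal, the functionals
  \<open>l \<circ> G\<^sup>j\<close> separate points on the span of the \<open>G\<^sup>k b\<close>; this yields both the independence of these vectors and
  the identity \<open>G\<^sup>n b = \<theta> b\<close>.
\<close>

lemma cyclic_shift_feedback:
  fixes F G :: "complex ^ 'n ^ 'n"
  assumes N: "N ** col_matrix (\<lambda>k. matrix_power F k *v b) = mat 1"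
    and G: "\<And>y. G *v y = F *v y +
      (N *v (\<theta> *s y - matrix_power F CARD('n) *v y)) $ idx (CARD('n) - 1) *s b"
  shows "det (col_matrix (\<lambda>k. matrix_power G k *v b)) \<noteq> 0"
    and "matrix_power G CARD('n) *v b = \<theta> *s b"
proof -
  define n where "n = CARD('n)"
  have n: "n > 0" by (simp add: n_def)
  define l where "l y = (N *v y) $ (idx (n - 1) :: 'n)" for y
  have l_simps: "l (y + z) = l y + l z" "l (y - z) = l y - l z" "l (c *s y) = c * l y"
    "l (\<Sum>k\<in>I. f k) = (\<Sum>k\<in>I. l (f k))" for y z c and f :: "nat \<Rightarrow> complex ^ 'n" and I
    by (simp_all add: l_def matrix_vector_right_distrib vec.diff vec.scale vec.sum)
  define h where "h y = l (\<theta> *s y - matrix_power F n *v y)" for y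
  have Gh: "G *v y = F *v y + h y *s b" for y
    using G by (simp add: h_def l_def n_def)
  have lF: "l (matrix_power F k *v b) = (if k = n - 1 then 1 else 0)" if "k < n" for k
  proof -
    have "N *v (matrix_power F k *v b) = axis (idx k) 1"
      using that
      by (subst col_matrix_axis[of k "\<lambda>k. matrix_power F k *v b", symmetric])
         (simp_all add: n_def N matrix_vector_mul_assoc)
    moreover have "(idx k :: 'n) = idx (n - 1) \<longleftrightarrow> k = n - 1"
      using that pos_idx[where 'n='n, of k] pos_idx[where 'n='n, of "n - 1"]
      unfolding n_def by (metis diff_less zero_less_card_finite zero_less_one)
    ultimately show ?thesis by (auto simp: l_def axis_def)
  qed
  have lG: "l (matrix_power G k *v y) = l (matrix_power F k *v y)" if "k < n" for k y
    using that
  proof (induction k arbitrary: y)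
    case (Suc k)
    have "l (matrix_power G (Suc k) *v y) = l (matrix_power F k *v (F *v y + h y *s b))"
      using Suc by (simp only: matrix_power_Suc_vec Gh)
    also have "\<dots> = l (matrix_power F (Suc k) *v y) + h y * l (matrix_power F k *v b)"
      by (simp only: matrix_vector_right_distrib vec.scale l_simps matrix_power_Suc_vec)
    also have "l (matrix_power F k *v b) = 0" using Suc.prems lF[of k] by simp
    finally show ?case by simp
  qed simp
  have lGn: "l (matrix_power G n *v y) = \<theta> * l y" for y
  proof -
    obtain m where m: "n = Suc m" using n gr0_implies_Suc by blast
    have "l (matrix_power G n *v y) = l (matrix_power G m *v (F *v y + h y *s b))"
      by (simp only: m matrix_power_Suc_vec Gh)
    also have "\<dots> = l (matrix_power F m *v (F *v y + h y *s b))"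
      using m by (intro lG) simp
    also have "\<dots> = l (matrix_power F n *v y) + h y * l (matrix_power F m *v b)"
      by (simp only: m matrix_vector_right_distrib vec.scale l_simps matrix_power_Suc_vec)
    also have "l (matrix_power F m *v b) = 1" using lF[of m] m by simp
    finally show ?thesis by (simp add: h_def l_simps)
  qed
  have coeffs: "c = 0"
    if vanish: "\<And>j. j < n \<Longrightarrow> l (matrix_power G j *v (col_matrix (\<lambda>k. matrix_power G k *v b) *v c)) = 0" for c
  proof -
    \<comment> \<open>the coefficients vanish from the highest down: \<open>l \<circ> G\<^sup>j\<close> isolates the one with index \<open>n - 1 - j\<close>\<close>
    have top: "c $ idx (n - 1 - j) = 0" if "j < n" for j
      using that
    proof (induction j rule: less_induct)
      case (less j)
      have "0 = l (matrix_power G j *v (col_matrix (\<lambda>k. matrix_power G k *v b) *v c))"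
        using vanish less.prems by simp
      also have "col_matrix (\<lambda>k. matrix_power G k *v b) *v c
          = (\<Sum>k<n. c $ idx k *s (matrix_power G k *v b))"
        unfolding col_matrix_mult n_def
        by (subst sum_pos[where 'n='n, symmetric]) simp
      also have "l (matrix_power G j *v \<dots>) = (\<Sum>k<n. c $ idx k * l (matrix_power G (j + k) *v b))"
        by (simp add: vec.sum vec.scale l_simps matrix_power_add_vec)
      also have "\<dots> = (\<Sum>k<n. if k = n - 1 - j then c $ idx k else 0)"
      proof (rule sum.cong[OF refl])
        fix k assume k: "k \<in> {..<n}"
        consider "k < n - 1 - j" | "k = n - 1 - j" | "k > n - 1 - j" by linarith
        then show "c $ idx k * l (matrix_power G (j + k) *v b) = (if k = n - 1 - j then c $ idx k else 0)"
        proof cases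
          case 3
          then have "c $ idx (n - 1 - (n - 1 - k)) = 0" using k by (intro less.IH) auto
          then show ?thesis using 3 k by simp
        qed (use k less.prems lG[of "j + k"] lF[of "j + k"] in auto)
      qed
      also have "\<dots> = c $ idx (n - 1 - j)" using n by simp
      finally show ?case by simp
    qed
    show ?thesis
    proof (subst vec_eq_iff, intro allI)
      fix i :: 'n
      show "c $ i = 0 $ i"
        using top[of "n - 1 - pos i"] pos_less[of i] by (simp add: n_def)
    qed
  qed
  have "c = 0" if "col_matrix (\<lambda>k. matrix_power G k *v b) *v c = 0" for c
    by (rule coeffs) (simp add: that l_def)
  then show det: "det (col_matrix (\<lambda>k. matrix_power G k *v b)) \<noteq> 0"
    unfolding det_nonzero_iff_injective by blast
  define z where "z = matrix_power G n *v b - \<theta> *s b"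
  obtain c where c: "col_matrix (\<lambda>k. matrix_power G k *v b) *v c = z"
    using cramer[OF det] by blast
  have "l (matrix_power G j *v z) = 0" for j
  proof -
    have "matrix_power G j *v (matrix_power G n *v b) = matrix_power G n *v (matrix_power G j *v b)"
      by (metis add.commute matrix_power_add_vec)
    then show ?thesis by (simp add: z_def vec.diff vec.scale l_simps lGn)
  qed
  then have "c = 0" using c by (intro coeffs) simp
  then show "matrix_power G CARD('n) *v b = \<theta> *s b" using c by (simp add: z_def n_def)
qed

text \<open>
  The gain \<open>K\<^sub>1\<close> turns the steered sequence into the orbit of \<open>b\<close> under \<open>F\<close>, and the additional gain of
  rank one, with image spanned by \<open>v\<close>, realises the feedback along \<open>b = Bv\<close> of
  \<open>cyclic_shift_feedback\<close>.
\<close>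

lemma ex_cyclic_feedback:
  fixes A :: "real \<Rightarrow> complex ^ 'n ^ 'n" and B :: "real \<Rightarrow> complex ^ 'm ^ 'n" and v :: "complex ^ 'm"
  assumes "a \<le> b" and A: "continuous_on {a..b} A" and B: "continuous_on {a..b} B"
    and "pointwise_reachable {a..b} A B" and v: "\<And>t. t \<in> {a..b} \<Longrightarrow> B t *v v \<noteq> 0"
  obtains K :: "real \<Rightarrow> complex ^ 'n ^ 'm" where "continuous_on {a..b} K"
    "\<And>t. t \<in> {a..b} \<Longrightarrow>
       det (col_matrix (\<lambda>k. matrix_power (A t + B t ** K t) k *v (B t *v v))) \<noteq> 0"
    "\<And>t. t \<in> {a..b} \<Longrightarrow>
       matrix_power (A t + B t ** K t) CARD('n) *v (B t *v v) = complex_of_real t *s (B t *v v)"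
proof -
  define x where "x t = B t *v v" for t
  have x: "continuous_on {a..b} x" unfolding x_def by (intro continuous_on_mult_vec B continuous_intros)
  obtain u where u: "continuous_on {a..b} u"
    and det: "\<And>t. t \<in> {a..b} \<Longrightarrow> det (col_matrix (steer (A t) (B t) (x t) (u t))) \<noteq> 0"
    by (rule ex_continuous_steer[OF \<open>a \<le> b\<close> A B x _ \<open>pointwise_reachable {a..b} A B\<close>])
       (use v in \<open>auto simp: x_def\<close>)
  obtain N where N: "continuous_on {a..b} N"
    and "\<And>t. t \<in> {a..b} \<Longrightarrow> col_matrix (steer (A t) (B t) (x t) (u t)) ** N t = mat 1"
    and N_inv: "\<And>t. t \<in> {a..b} \<Longrightarrow> N t ** col_matrix (steer (A t) (B t) (x t) (u t)) = mat 1"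
    using continuous_inverse_matrix[OF
        continuous_on_col_matrix[OF continuous_on_steer[OF A B x u]] det, of thesis] by blast
  define K1 where "K1 t = transpose (u t) ** N t" for t
  define F where "F t = A t + B t ** K1 t" for t
  have K1_cont: "continuous_on {a..b} K1"
    unfolding K1_def transpose_def by (intro continuous_on_matrix_mult continuous_intros u N)
  have F_cont: "continuous_on {a..b} F"
    unfolding F_def by (intro continuous_on_matrix_mult continuous_intros K1_cont A B)
  have F_power: "matrix_power (F t) k *v x t = steer (A t) (B t) (x t) (u t) k"
    if t: "t \<in> {a..b}" and "k < CARD('n)" for t k
    using \<open>k < CARD('n)\<close>
  proof (induction k)
    case (Suc k)
    let ?y = "steer (A t) (B t) (x t) (u t) k"
    have "N t *v ?y = axis (idx k) 1"
      using Suc.prems N_inv[OF t]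
      by (subst col_matrix_axis[symmetric]) (simp_all add: matrix_vector_mul_assoc)
    moreover have "K1 t *v ?y = transpose (u t) *v (N t *v ?y)"
      by (simp add: K1_def matrix_vector_mul_assoc)
    moreover have "transpose (u t) *v axis (idx k) 1 = u t $ idx k"
      by (simp add: mult_axis_eq_column column_def transpose_def vec_eq_iff)
    ultimately have "K1 t *v ?y = u t $ idx k" by (simp only:)
    then show ?case using Suc
      by (simp add: F_def matrix_vector_mult_add_rdistrib flip: matrix_vector_mul_assoc)
  qed simp
  have F_col: "col_matrix (\<lambda>k. matrix_power (F t) k *v x t) = col_matrix (steer (A t) (B t) (x t) (u t))"
    if "t \<in> {a..b}" for t
    by (simp add: col_matrix_def vec_eq_iff F_power[OF that] pos_less)
  define g where "g t = (N t ** (t *\<^sub>R mat 1 - matrix_power (F t) CARD('n))) $ idx (CARD('n) - 1)" for t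
  define K where "K t = K1 t + (\<chi> i j. v $ i * g t $ j)" for t
  have "continuous_on {a..b} K"
    unfolding K_def g_def
    by (intro continuous_intros K1_cont continuous_on_matrix_mult N continuous_on_matrix_power F_cont)
  have G: "(A t + B t ** K t) *v y = F t *v y +
      (N t *v (complex_of_real t *s y - matrix_power (F t) CARD('n) *v y)) $ idx (CARD('n) - 1) *s x t"
    for t y
  proof -
    define R where "R = N t ** (t *\<^sub>R mat 1 - matrix_power (F t) CARD('n))"
    have "(\<chi> i j. v $ i * g t $ j) *v y = (R *v y) $ idx (CARD('n) - 1) *s v"
      by (simp add: g_def R_def[symmetric] matrix_vector_mult_def vec_eq_iff sum_distrib_left ac_simps)
    moreover have "R *v y = N t *v (complex_of_real t *s y - matrix_power (F t) CARD('n) *v y)"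
    proof -
      have "(t *\<^sub>R mat 1) *v y = complex_of_real t *s y"
        by (simp add: scaleR_matrix_mult_vec scaleR_eq_smult)
      then show ?thesis
        by (simp add: R_def matrix_vector_mult_diff_rdistrib flip: matrix_vector_mul_assoc)
    qed
    ultimately show ?thesis
      by (simp add: K_def F_def x_def matrix_add_ldistrib matrix_vector_mult_add_rdistrib vec.scale
          flip: matrix_vector_mul_assoc)
  qed
  show thesis
  proof (rule that)
    show "continuous_on {a..b} K" by fact
  next
    fix t assume t: "t \<in> {a..b}"
    have "N t ** col_matrix (\<lambda>k. matrix_power (F t) k *v x t) = mat 1"
      by (simp only: F_col[OF t] N_inv[OF t])
    note cyclic = cyclic_shift_feedback[OF this G]
    show "det (col_matrix (\<lambda>k. matrix_power (A t + B t ** K t) k *v (B t *v v))) \<noteq> 0"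
      using cyclic(1) unfolding x_def .
    show "matrix_power (A t + B t ** K t) CARD('n) *v (B t *v v) = complex_of_real t *s (B t *v v)"
      using cyclic(2) unfolding x_def .
  qed
qed

section \<open>Uniform density of cyclic orbits\<close>

definition complex_subspace :: "('p \<Rightarrow> complex ^ 'n) set \<Rightarrow> bool" where
  "complex_subspace L \<longleftrightarrow> (\<lambda>_. 0) \<in> L \<and> (\<forall>f\<in>L. \<forall>g\<in>L. (\<lambda>t. f t + g t) \<in> L) \<and>
     (\<forall>c. \<forall>f\<in>L. (\<lambda>t. c *s f t) \<in> L)"

text \<open>
  The elements of the closure are arbitrary functions whose values outside \<open>P\<close> are irrelevant; a type
  of continuous functions on \<open>P\<close> is avoided in this way.
\<close>

definition uniform_closure ::
    "'p set \<Rightarrow> ('p \<Rightarrow> complex ^ 'n) set \<Rightarrow> ('p \<Rightarrow> complex ^ 'n) set" where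
  "uniform_closure P L = {f. \<forall>\<epsilon>>0. \<exists>g\<in>L. \<forall>t\<in>P. norm (g t - f t) < \<epsilon>}"

lemma uniform_closureD:
  "f \<in> uniform_closure P L \<Longrightarrow> \<epsilon> > 0 \<Longrightarrow> \<exists>g\<in>L. \<forall>t\<in>P. norm (g t - f t) < \<epsilon>"
  unfolding uniform_closure_def by blast

lemma uniform_closure_superset: "f \<in> L \<Longrightarrow> f \<in> uniform_closure P L"
  unfolding uniform_closure_def by (auto intro!: bexI[of _ f])

lemma uniform_closure_closed:
  assumes "\<And>\<epsilon>. \<epsilon> > 0 \<Longrightarrow> \<exists>g\<in>uniform_closure P L. \<forall>t\<in>P. norm (g t - f t) < \<epsilon>"
  shows "f \<in> uniform_closure P L"
  unfolding uniform_closure_def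
proof (intro CollectI allI impI)
  fix \<epsilon> :: real assume "\<epsilon> > 0"
  then obtain g where g: "g \<in> uniform_closure P L" "\<forall>t\<in>P. norm (g t - f t) < \<epsilon> / 2"
    using assms[of "\<epsilon> / 2"] by auto
  then obtain k where k: "k \<in> L" "\<forall>t\<in>P. norm (k t - g t) < \<epsilon> / 2"
    using uniform_closureD[of g P L "\<epsilon> / 2"] \<open>\<epsilon> > 0\<close> by auto
  have "norm (k t - f t) < \<epsilon>" if "t \<in> P" for t
    using g k that by (metis norm_diff_triangle_less field_sum_of_halves)
  then show "\<exists>g\<in>L. \<forall>t\<in>P. norm (g t - f t) < \<epsilon>" using k by blast
qed

lemma uniform_closure_cong:
  "f \<in> uniform_closure P L \<Longrightarrow> (\<And>t. t \<in> P \<Longrightarrow> f t = g t) \<Longrightarrow> g \<in> uniform_closure P L"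
  unfolding uniform_closure_def by simp

lemma norm_smult: "norm (c *s x) = cmod c * norm x" for x :: "complex ^ 'n"
  by (simp add: norm_vec_def norm_mult L2_set_right_distrib)

lemma complex_subspace_uniform_closure:
  assumes L: "complex_subspace L"
  shows "complex_subspace (uniform_closure P L)"
  unfolding complex_subspace_def
proof (intro conjI ballI allI)
  show "(\<lambda>_. 0) \<in> uniform_closure P L"
    using L by (intro uniform_closure_superset) (simp add: complex_subspace_def)
next
  fix f g assume fg: "f \<in> uniform_closure P L" "g \<in> uniform_closure P L"
  show "(\<lambda>t. f t + g t) \<in> uniform_closure P L"
    unfolding uniform_closure_def
  proof (intro CollectI allI impI)
    fix \<epsilon> :: real assume "\<epsilon> > 0"
    then have half: "\<epsilon> / 2 > 0" by simp
    obtain f' where f': "f' \<in> L" "\<forall>t\<in>P. norm (f' t - f t) < \<epsilon> / 2"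
      using uniform_closureD[OF fg(1) half] by blast
    obtain g' where g': "g' \<in> L" "\<forall>t\<in>P. norm (g' t - g t) < \<epsilon> / 2"
      using uniform_closureD[OF fg(2) half] by blast
    have "norm (f' t + g' t - (f t + g t)) < \<epsilon>" if "t \<in> P" for t
    proof -
      have "norm (f' t + g' t - (f t + g t)) \<le> norm (f' t - f t) + norm (g' t - g t)"
        by (rule norm_diff_triangle_ineq)
      also have "\<dots> < \<epsilon> / 2 + \<epsilon> / 2" using f' g' that by (intro add_strict_mono) auto
      finally show ?thesis by simp
    qed
    moreover have "(\<lambda>t. f' t + g' t) \<in> L" using L f' g' by (simp add: complex_subspace_def)
    ultimately show "\<exists>k\<in>L. \<forall>t\<in>P. norm (k t - (f t + g t)) < \<epsilon>" by (intro bexI[rotated] ballI)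
  qed
next
  fix c f assume f: "f \<in> uniform_closure P L"
  show "(\<lambda>t. c *s f t) \<in> uniform_closure P L"
    unfolding uniform_closure_def
  proof (intro CollectI allI impI)
    fix \<epsilon> :: real assume \<epsilon>: "\<epsilon> > 0"
    then have pos: "\<epsilon> / (cmod c + 1) > 0" by (intro divide_pos_pos add_nonneg_pos) auto
    obtain g where g: "g \<in> L" "\<forall>t\<in>P. norm (g t - f t) < \<epsilon> / (cmod c + 1)"
      using uniform_closureD[OF f pos] by blast
    have "norm (c *s g t - c *s f t) < \<epsilon>" if "t \<in> P" for t
    proof -
      have "norm (c *s g t - c *s f t) = cmod c * norm (g t - f t)"
        by (simp only: norm_smult flip: vec.scale_right_diff_distrib)
      also have "\<dots> \<le> cmod c * (\<epsilon> / (cmod c + 1))"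
        using g that by (intro mult_left_mono) (auto intro: less_imp_le)
      also have "\<dots> < (cmod c + 1) * (\<epsilon> / (cmod c + 1))"
        using \<epsilon> by (intro mult_strict_right_mono) (auto intro!: divide_pos_pos add_nonneg_pos)
      also have "\<dots> = \<epsilon>" by (simp add: add_nonneg_eq_0_iff)
      finally show ?thesis .
    qed
    moreover have "(\<lambda>t. c *s g t) \<in> L" using L g by (simp add: complex_subspace_def)
    ultimately show "\<exists>k\<in>L. \<forall>t\<in>P. norm (k t - c *s f t) < \<epsilon>" by (intro bexI[rotated] ballI)
  qed
qed

lemma complex_subspace_add: "complex_subspace L \<Longrightarrow> f \<in> L \<Longrightarrow> g \<in> L \<Longrightarrow> (\<lambda>t. f t + g t) \<in> L"
  by (simp add: complex_subspace_def)

lemma complex_subspace_scale: "complex_subspace L \<Longrightarrow> f \<in> L \<Longrightarrow> (\<lambda>t. c *s f t) \<in> L"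
  by (simp add: complex_subspace_def)

lemma complex_subspace_sum:
  "complex_subspace L \<Longrightarrow> (\<And>i. i \<in> I \<Longrightarrow> f i \<in> L) \<Longrightarrow> (\<lambda>t. \<Sum>i\<in>I. f i t) \<in> L"
  by (induction I rule: infinite_finite_induct) (auto simp: complex_subspace_def)

text \<open>
  By Weierstrass \<open>c\<close> is a uniform limit of polynomials on the interval, and \<open>x\<close> is bounded there.
\<close>

lemma uniform_closure_real_mult:
  fixes x :: "real \<Rightarrow> complex ^ 'n"
  assumes L: "complex_subspace L"
    and mono: "\<And>j. (\<lambda>t. complex_of_real t ^ j *s x t) \<in> uniform_closure {a..b} L"
    and x: "continuous_on {a..b} x" and c: "continuous_on {a..b} c"
  shows "(\<lambda>t. complex_of_real (c t) *s x t) \<in> uniform_closure {a..b} L"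
proof (rule uniform_closure_closed)
  fix \<epsilon> :: real assume "\<epsilon> > 0"
  have "bounded (x ` {a..b})"
    by (intro compact_imp_bounded compact_continuous_image x) auto
  then obtain M where M: "M > 0" "\<And>t. t \<in> {a..b} \<Longrightarrow> norm (x t) \<le> M"
    unfolding bounded_pos by auto
  obtain g where g: "real_polynomial_function g" "\<And>t. t \<in> {a..b} \<Longrightarrow> \<bar>c t - g t\<bar> < \<epsilon> / M"
    using Stone_Weierstrass_real_polynomial_function[of "{a..b}" c "\<epsilon> / M"] c M \<open>\<epsilon> > 0\<close> by auto
  obtain q N where q: "g = (\<lambda>t. \<Sum>i\<le>N. q i * t ^ i)"
    using g(1) unfolding real_polynomial_function_iff_sum by blast
  have "(\<lambda>t. \<Sum>i\<le>N. complex_of_real (q i) *s (complex_of_real t ^ i *s x t)) \<in> uniform_closure {a..b} L"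
    by (intro complex_subspace_sum complex_subspace_scale complex_subspace_uniform_closure L mono)
  also have "(\<lambda>t. \<Sum>i\<le>N. complex_of_real (q i) *s (complex_of_real t ^ i *s x t))
      = (\<lambda>t. complex_of_real (g t) *s x t)"
    by (simp add: q vec.scale_sum_left)
  finally have "(\<lambda>t. complex_of_real (g t) *s x t) \<in> uniform_closure {a..b} L" .
  moreover have "norm (complex_of_real (g t) *s x t - complex_of_real (c t) *s x t) < \<epsilon>"
    if t: "t \<in> {a..b}" for t
  proof -
    have "norm (complex_of_real (g t) *s x t - complex_of_real (c t) *s x t) = \<bar>g t - c t\<bar> * norm (x t)"
      by (simp only: norm_smult norm_of_real flip: vec.scale_left_diff_distrib of_real_diff)
    also have "\<dots> \<le> \<bar>g t - c t\<bar> * M" using M t by (intro mult_left_mono) auto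
    also have "\<dots> < \<epsilon> / M * M" using g(2)[OF t] M by (intro mult_strict_right_mono) auto
    also have "\<dots> = \<epsilon>" using M by simp
    finally show ?thesis .
  qed
  ultimately show "\<exists>k\<in>uniform_closure {a..b} L.
      \<forall>t\<in>{a..b}. norm (k t - complex_of_real (c t) *s x t) < \<epsilon>" by (intro bexI[rotated] ballI)
qed

text \<open>
  The real case applies to the real and the imaginary part, since \<open>L\<close> is a complex space.
\<close>

lemma uniform_closure_complex_mult:
  fixes x :: "real \<Rightarrow> complex ^ 'n"
  assumes L: "complex_subspace L"
    and mono: "\<And>j. (\<lambda>t. complex_of_real t ^ j *s x t) \<in> uniform_closure {a..b} L"
    and x: "continuous_on {a..b} x" and c: "continuous_on {a..b} c"
  shows "(\<lambda>t. c t *s x t) \<in> uniform_closure {a..b} L"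
proof -
  have "(\<lambda>t. complex_of_real (Re (c t)) *s x t + \<i> *s (complex_of_real (Im (c t)) *s x t))
      \<in> uniform_closure {a..b} L"
    by (intro complex_subspace_add complex_subspace_scale complex_subspace_uniform_closure L
        uniform_closure_real_mult mono x continuous_on_Re continuous_on_Im c)
  also have "(\<lambda>t. complex_of_real (Re (c t)) *s x t + \<i> *s (complex_of_real (Im (c t)) *s x t))
      = (\<lambda>t. c t *s x t)"
    by (simp only: vec.scale_scale flip: vec.scale_left_distrib complex_eq)
  finally show ?thesis .
qed

text \<open>
  Multiplication by the parameter moves \<open>n\<close> steps along the orbit of \<open>x\<close>.  The closure thus contains
  every monomial multiple of the first \<open>n\<close> vectors of the orbit, then every continuous multiple, and
  these vectors form a basis.
\<close>

lemma cyclic_shift_dense: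
  fixes G :: "real \<Rightarrow> complex ^ 'n ^ 'n"
  assumes L: "complex_subspace L"
    and G: "continuous_on {a..b} G" and x: "continuous_on {a..b} x"
    and det: "\<And>t. t \<in> {a..b} \<Longrightarrow> det (col_matrix (\<lambda>k. matrix_power (G t) k *v x t)) \<noteq> 0"
    and shift: "\<And>t. t \<in> {a..b} \<Longrightarrow> matrix_power (G t) CARD('n) *v x t = complex_of_real t *s x t"
    and orbit: "\<And>k. (\<lambda>t. matrix_power (G t) k *v x t) \<in> uniform_closure {a..b} L"
    and f: "continuous_on {a..b} f"
  shows "f \<in> uniform_closure {a..b} L"
proof -
  have Gx: "continuous_on {a..b} (\<lambda>t. matrix_power (G t) k *v x t)" for k
    by (intro continuous_on_mult_vec continuous_on_matrix_power G x)
  have shift_power: "matrix_power (G t) (k + j * CARD('n)) *v x t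
      = complex_of_real t ^ j *s (matrix_power (G t) k *v x t)" if "t \<in> {a..b}" for t j k
  proof (induction j arbitrary: k)
    case (Suc j)
    have "matrix_power (G t) (k + Suc j * CARD('n)) *v x t
        = matrix_power (G t) (k + j * CARD('n)) *v (complex_of_real t *s x t)"
    proof -
      have "k + Suc j * CARD('n) = (k + j * CARD('n)) + CARD('n)" by simp
      then show ?thesis by (simp only: matrix_power_add_vec shift[OF that])
    qed
    then show ?case by (simp add: vec.scale Suc)
  qed simp
  have mono: "(\<lambda>t. complex_of_real t ^ j *s (matrix_power (G t) k *v x t)) \<in> uniform_closure {a..b} L" for j k
    by (rule uniform_closure_cong[OF orbit[of "k + j * CARD('n)"]]) (rule shift_power)
  obtain N where N: "continuous_on {a..b} N"
    and N_inv: "\<And>t. t \<in> {a..b} \<Longrightarrow> col_matrix (\<lambda>k. matrix_power (G t) k *v x t) ** N t = mat 1"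
    using continuous_inverse_matrix[OF continuous_on_col_matrix[OF Gx] det, of thesis] by blast
  define c where "c t = N t *v f t" for t
  have c: "continuous_on {a..b} (\<lambda>t. c t $ i)" for i
    unfolding c_def by (intro continuous_intros continuous_on_mult_vec N f)
  have "(\<lambda>t. \<Sum>i\<in>UNIV. c t $ i *s (matrix_power (G t) (pos i) *v x t)) \<in> uniform_closure {a..b} L"
    by (rule complex_subspace_sum[OF complex_subspace_uniform_closure[OF L]])
       (rule uniform_closure_complex_mult[OF L mono Gx c])
  moreover have "(\<Sum>i\<in>UNIV. c t $ i *s (matrix_power (G t) (pos i) *v x t)) = f t"
    if "t \<in> {a..b}" for t
    unfolding c_def
    by (subst col_matrix_mult[symmetric]) (simp add: matrix_vector_mul_assoc N_inv[OF that])
  ultimately show ?thesis by (rule uniform_closure_cong)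
qed

section \<open>The matrix exponential and states in continuous time\<close>

lemma scaleR_matrix_mult:
  "(r *\<^sub>R A) ** B = r *\<^sub>R (A ** B)" "A ** (r *\<^sub>R B) = r *\<^sub>R (A ** B)"
  for A :: "complex ^ 'k ^ 'n" and B :: "complex ^ 'l ^ 'k"
  by (simp_all add: matrix_matrix_mult_def vec_eq_iff scaleR_sum_right)

lemma matrix_power_scaleR: "matrix_power (s *\<^sub>R A) k = s ^ k *\<^sub>R matrix_power A k"
  by (induction k) (simp_all add: scaleR_matrix_mult)

lemma bilinear_matrix_mult: "bilinear ((**) :: complex ^ 'k ^ 'n \<Rightarrow> complex ^ 'l ^ 'k \<Rightarrow> _)"
  unfolding bilinear_def
  by (auto intro!: linearI simp: scaleR_matrix_mult matrix_add_ldistrib)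
     (simp add: matrix_matrix_mult_def vec_eq_iff distrib_right sum.distrib)

lemma bilinear_matrix_vector_mult: "bilinear ((*v) :: complex ^ 'k ^ 'n \<Rightarrow> complex ^ 'k \<Rightarrow> _)"
  unfolding bilinear_def
  by (auto intro!: linearI simp: matrix_vector_mult_add_rdistrib matrix_vector_right_distrib
      scaleR_matrix_mult_vec scaleR_eq_smult vec.scale)

text \<open>
  The point of this bound is that it is uniform over all matrices in a ball.  The norm of matrices is
  only submultiplicative up to a factor \<open>c\<close>, which is absorbed into the radius.  For \<open>m = 0\<close> the
  bound says that the exponential is bounded.
\<close>

lemma matrix_exp_taylor:
  obtains C where "C > 0"
    "\<And>A :: complex ^ 'n ^ 'n. \<And>s. norm A \<le> r \<Longrightarrow> 0 \<le> s \<Longrightarrow>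
       s \<le> 1 \<Longrightarrow> norm (matrix_exp (s *\<^sub>R A) - (\<Sum>k<m. (s ^ k / fact k) *\<^sub>R matrix_power A k)) \<le> C * s ^ m"
proof -
  obtain c where c: "c > 0" "\<And>(A :: complex ^ 'n ^ 'n) (B :: complex ^ 'n ^ 'n). norm (A ** B) \<le> c * norm A * norm B"
    using bilinear_bounded_pos[OF bilinear_matrix_mult] by metis
  define d where "d = norm (mat 1 :: complex ^ 'n ^ 'n)"
  define q where "q = c * max r 0"
  have q: "q \<ge> 0" using c by (simp add: q_def)
  have dn: "d \<ge> 0" by (simp add: d_def)
  have power: "norm (matrix_power A k) \<le> d * q ^ k" if "norm A \<le> r" for A :: "complex ^ 'n ^ 'n" and k
  proof (induction k)
    case (Suc k)
    have "norm (matrix_power A (Suc k)) \<le> c * norm A * norm (matrix_power A k)" using c by simp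
    also have "\<dots> \<le> q * (d * q ^ k)"
      unfolding q_def using that c Suc by (intro mult_mono) (auto simp: q_def)
    finally show ?case by (simp add: ac_simps)
  qed (simp add: d_def)
  define e where "e k = d * (q ^ k / fact k)" for k
  have e_sums: "e sums (d * exp q)"
    unfolding e_def using sums_mult[OF exp_converges[of q], of d] by (simp add: field_simps)
  have e_nonneg: "e k \<ge> 0" for k using q dn by (simp add: e_def)
  show thesis
  proof (rule that[of "d * exp q + 1"])
    show "d * exp q + 1 > 0" using dn by (intro add_nonneg_pos) auto
    fix A :: "complex ^ 'n ^ 'n" and s :: real
    assume A: "norm A \<le> r" and s: "0 \<le> s" "s \<le> 1"
    define f where "f k = (s ^ k / fact k) *\<^sub>R matrix_power A k" for k
    have f_bound: "norm (f k) \<le> s ^ k * e k" for k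
    proof -
      have "norm (f k) = s ^ k / fact k * norm (matrix_power A k)" using s by (simp add: f_def)
      also have "\<dots> \<le> s ^ k / fact k * (d * q ^ k)" using power[OF A] s by (intro mult_left_mono) auto
      finally show ?thesis by (simp add: e_def)
    qed
    have f_bound': "norm (f (k + m)) \<le> s ^ m * e (k + m)" for k
    proof -
      have "s ^ (k + m) \<le> s ^ m" using s by (simp add: power_add mult_left_le_one_le power_le_one)
      then show ?thesis using f_bound[of "k + m"] e_nonneg[of "k + m"]
        by (meson mult_right_mono order_trans)
    qed
    have e_tail: "summable (\<lambda>k. s ^ m * e (k + m))"
      using e_sums by (intro summable_mult summable_ignore_initial_segment) (rule sums_summable)
    have norm_tail: "summable (\<lambda>k. norm (f (k + m)))"
      by (rule summable_comparison_test'[OF e_tail]) (use f_bound' in simp)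
    then have "summable (\<lambda>k. norm (f k))"
      using summable_iff_shift[of "\<lambda>k. norm (f k)" m] by simp
    then have f: "summable f" by (rule summable_norm_cancel)
    have "matrix_exp (s *\<^sub>R A) = (\<Sum>k. f k)"
      by (simp add: matrix_exp_def f_def matrix_power_scaleR field_simps)
    also have "\<dots> = (\<Sum>k. f (k + m)) + (\<Sum>k<m. f k)" by (rule suminf_split_initial_segment[OF f])
    finally have "norm (matrix_exp (s *\<^sub>R A) - (\<Sum>k<m. f k)) = norm (\<Sum>k. f (k + m))" by simp
    also have "\<dots> \<le> (\<Sum>k. norm (f (k + m)))"
      by (rule summable_norm[OF norm_tail])
    also have "\<dots> \<le> (\<Sum>k. s ^ m * e (k + m))"
      by (rule suminf_le[OF f_bound' norm_tail e_tail])
    also have "\<dots> = s ^ m * (\<Sum>k. e (k + m))"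
      using e_sums by (intro suminf_mult summable_ignore_initial_segment) (rule sums_summable)
    also have "\<dots> \<le> s ^ m * (d * exp q)"
    proof (rule mult_left_mono)
      have "(\<Sum>k. e (k + m)) = d * exp q - (\<Sum>k<m. e k)"
        using e_sums suminf_minus_initial_segment[of e m] by (simp add: sums_iff)
      then show "(\<Sum>k. e (k + m)) \<le> d * exp q" using e_nonneg by (simp add: sum_nonneg)
    qed (use s in simp)
    also have "\<dots> \<le> (d * exp q + 1) * s ^ m" using s by (simp add: algebra_simps)
    finally show "norm (matrix_exp (s *\<^sub>R A) - (\<Sum>k<m. (s ^ k / fact k) *\<^sub>R matrix_power A k))
        \<le> (d * exp q + 1) * s ^ m"
      by (simp add: f_def)
  qed
qed

lemma borel_measurable_matrix_exp_scaleR: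
  "(\<lambda>s. matrix_exp (g s *\<^sub>R A)) \<in> borel_measurable M"
  if [measurable]: "g \<in> borel_measurable M" for A :: "complex ^ 'n ^ 'n"
  unfolding matrix_exp_def matrix_power_scaleR by measurable

lemma absolutely_integrable_state:
  fixes A :: "complex ^ 'n ^ 'n" and B :: "complex ^ 'm ^ 'n"
  assumes u: "u absolutely_integrable_on {0..1}"
  shows "(\<lambda>\<tau>. matrix_exp ((1 - \<tau>) *\<^sub>R A) *v (B *v u \<tau>)) absolutely_integrable_on {0..1}"
proof (rule absolutely_integrable_bounded_measurable_product[OF bilinear_matrix_vector_mult])
  have "(\<lambda>\<tau>. matrix_exp ((1 - \<tau>) *\<^sub>R A)) \<in> borel_measurable lborel"
    by (intro borel_measurable_matrix_exp_scaleR) measurable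
  then have "(\<lambda>\<tau>. matrix_exp ((1 - \<tau>) *\<^sub>R A)) \<in> borel_measurable lebesgue"
    by (rule measurable_completion)
  then show "(\<lambda>\<tau>. matrix_exp ((1 - \<tau>) *\<^sub>R A)) \<in> borel_measurable (lebesgue_on {0..1})"
    by (rule measurable_restrict_space1)
  obtain C where "\<And>s. 0 \<le> s \<Longrightarrow> s \<le> 1 \<Longrightarrow> norm (matrix_exp (s *\<^sub>R A)) \<le> C"
  proof (rule matrix_exp_taylor[where r = "norm A" and m = 0 and 'n = 'n])
    fix C assume "\<And>A' :: complex ^ 'n ^ 'n. \<And>s. norm A' \<le> norm A \<Longrightarrow> 0 \<le> s \<Longrightarrow> s \<le> 1 \<Longrightarrow>
      norm (matrix_exp (s *\<^sub>R A') - (\<Sum>k<0. (s ^ k / fact k) *\<^sub>R matrix_power A' k)) \<le> C * s ^ 0"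
    from this[of A] show thesis by (intro that[of C]) simp
  qed
  then show "bounded ((\<lambda>\<tau>. matrix_exp ((1 - \<tau>) *\<^sub>R A)) ` {0..1})"
    unfolding bounded_iff by (intro exI[of _ C]) auto
  have "bounded_linear ((*v) B)" by simp
  from absolutely_integrable_linear[OF u this]
  show "(\<lambda>\<tau>. B *v u \<tau>) absolutely_integrable_on {0..1}" by (simp add: o_def)
qed simp

lemma state_ct_add:
  assumes "u absolutely_integrable_on {0..1}" "w absolutely_integrable_on {0..1}"
  shows "state_ct A B (\<lambda>\<tau>. u \<tau> + w \<tau>) 1 = state_ct A B u 1 + state_ct A B w 1"
  using set_integral_add(2)[OF absolutely_integrable_state[OF assms(1), of A B]
      absolutely_integrable_state[OF assms(2), of A B]]
  by (simp add: state_ct_def matrix_vector_right_distrib)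

lemma bounded_linear_smult: "bounded_linear ((*s) c)" for c :: complex
  by (intro linear_conv_bounded_linear[THEN iffD1] linearI)
     (simp_all add: vec.scale_right_distrib scaleR_eq_smult mult.commute)

lemma state_ct_scale:
  assumes "u absolutely_integrable_on {0..1}"
  shows "state_ct A B (\<lambda>\<tau>. c *s u \<tau>) 1 = c *s state_ct A B u 1"
  using integral_bounded_linear[OF bounded_linear_smult
      absolutely_integrable_state[OF assms, of A B, unfolded set_integrable_def], of c]
  by (simp add: state_ct_def set_lebesgue_integral_def vec.scale scaleR_eq_smult mult.commute)

text \<open>
  The final time \<open>1\<close> suffices for all approximations; with the time fixed, superposition of inputs
  makes this a vector space.
\<close>

definition reachable_states_ct ::
    "('p \<Rightarrow> complex ^ 'n ^ 'n) \<Rightarrow> ('p \<Rightarrow> complex ^ 'm ^ 'n) \<Rightarrow> ('p \<Rightarrow> complex ^ 'n) set" where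
  "reachable_states_ct A B =
     {\<lambda>t. state_ct (A t) (B t) u 1 | u. u absolutely_integrable_on {0..1}}"

lemma complex_subspace_reachable_states_ct:
  fixes A :: "'p \<Rightarrow> complex ^ 'n ^ 'n" and B :: "'p \<Rightarrow> complex ^ 'm ^ 'n"
  shows "complex_subspace (reachable_states_ct A B)"
  unfolding complex_subspace_def
proof (intro conjI ballI allI)
  have "(\<lambda>_. 0) = (\<lambda>t. state_ct (A t) (B t) (\<lambda>_. 0) 1)" by (simp add: state_ct_def)
  moreover have "(\<lambda>_. 0 :: complex ^ 'm) absolutely_integrable_on {0..1 :: real}" by simp
  ultimately show "(\<lambda>_. 0) \<in> reachable_states_ct A B" unfolding reachable_states_ct_def by blast
next
  fix f g assume "f \<in> reachable_states_ct A B" "g \<in> reachable_states_ct A B"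
  then obtain u w where u: "f = (\<lambda>t. state_ct (A t) (B t) u 1)" "u absolutely_integrable_on {0..1}"
    and w: "g = (\<lambda>t. state_ct (A t) (B t) w 1)" "w absolutely_integrable_on {0..1}"
    unfolding reachable_states_ct_def by blast
  then have "(\<lambda>t. f t + g t) = (\<lambda>t. state_ct (A t) (B t) (\<lambda>\<tau>. u \<tau> + w \<tau>) 1)"
    by (simp add: state_ct_add)
  then show "(\<lambda>t. f t + g t) \<in> reachable_states_ct A B"
    using set_integral_add(1)[OF u(2) w(2)] unfolding reachable_states_ct_def by blast
next
  fix c f assume "f \<in> reachable_states_ct A B"
  then obtain u where u: "f = (\<lambda>t. state_ct (A t) (B t) u 1)" "u absolutely_integrable_on {0..1}"
    unfolding reachable_states_ct_def by blast
  then have "(\<lambda>t. c *s f t) = (\<lambda>t. state_ct (A t) (B t) (\<lambda>\<tau>. c *s u \<tau>) 1)"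
    by (simp add: state_ct_scale)
  then show "(\<lambda>t. c *s f t) \<in> reachable_states_ct A B"
    using absolutely_integrable_linear[OF u(2) bounded_linear_smult[of c]]
    unfolding reachable_states_ct_def o_def by blast
qed

section \<open>Pulse inputs\<close>

text \<open>
  The total mass is \<open>v\<close>, concentrated just before the final time \<open>1\<close>.
\<close>

definition pulse :: "real \<Rightarrow> complex ^ 'm \<Rightarrow> real \<Rightarrow> complex ^ 'm" where
  "pulse h v \<tau> = (if \<tau> \<in> {1 - h..1} then (1 / h) *\<^sub>R v else 0)"

lemma absolutely_integrable_pulse:
  assumes "0 < h" "h \<le> 1"
  shows "pulse h v absolutely_integrable_on {0..1}"
proof -
  have "(\<lambda>_. (1 / h) *\<^sub>R v) absolutely_integrable_on {1 - h..1}"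
    by (intro absolutely_integrable_continuous_real continuous_intros)
  then have "(\<lambda>\<tau>. if \<tau> \<in> {1 - h..1} then (1 / h) *\<^sub>R v else 0) absolutely_integrable_on UNIV"
    by (simp only: absolutely_integrable_restrict_UNIV)
  then show ?thesis
    unfolding pulse_def by (rule set_integrable_subset) auto
qed

lemma has_integral_taylor_polynomial:
  fixes x :: "nat \<Rightarrow> 'v::euclidean_space"
  assumes h: "0 < h"
  shows "((\<lambda>\<tau>. (1 / h) *\<^sub>R (\<Sum>k<m. ((1 - \<tau>) ^ k / fact k) *\<^sub>R x k)) has_integral
           (\<Sum>k<m. (h ^ k / fact (Suc k)) *\<^sub>R x k)) {1 - h..1}"
proof -
  define \<Phi> where "\<Phi> \<tau> = (1 / h) *\<^sub>R (\<Sum>k<m. (- ((1 - \<tau>) ^ Suc k / fact (Suc k))) *\<^sub>R x k)" for \<tau> :: real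
  have deriv: "((\<lambda>\<tau>. - ((1 - \<tau>) ^ Suc k / fact (Suc k))) has_real_derivative (1 - \<tau>) ^ k / fact k)
      (at \<tau> within {1 - h..1})" for k \<tau>
    by (rule derivative_eq_intros refl | simp add: field_simps del: power_Suc fact_Suc)+
       (simp add: fact_Suc field_simps)
  have "((\<lambda>\<tau>. (- ((1 - \<tau>) ^ Suc k / fact (Suc k))) *\<^sub>R x k) has_vector_derivative
      ((1 - \<tau>) ^ k / fact k) *\<^sub>R x k) (at \<tau> within {1 - h..1})" for k \<tau>
    using has_vector_derivative_scaleR[OF deriv has_vector_derivative_const[of "x k"]] by simp
  then have "(\<Phi> has_vector_derivative (1 / h) *\<^sub>R (\<Sum>k<m. ((1 - \<tau>) ^ k / fact k) *\<^sub>R x k))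
      (at \<tau> within {1 - h..1})" for \<tau>
    unfolding \<Phi>_def
    by (intro bounded_linear.has_vector_derivative[OF bounded_linear_scaleR_right]
        has_vector_derivative_sum)
  then have "((\<lambda>\<tau>. (1 / h) *\<^sub>R (\<Sum>k<m. ((1 - \<tau>) ^ k / fact k) *\<^sub>R x k)) has_integral
      \<Phi> 1 - \<Phi> (1 - h)) {1 - h..1}"
    using h by (intro fundamental_theorem_of_calculus) auto
  moreover have "\<Phi> 1 - \<Phi> (1 - h) = (\<Sum>k<m. (h ^ k / fact (Suc k)) *\<^sub>R x k)"
    using h by (simp add: \<Phi>_def sum_negf scaleR_sum_right del: fact_Suc)
  ultimately show ?thesis by simp
qed

text \<open>
  Integrating the Taylor expansion of the exponential over the pulse gives the sum; the remainder is
  \<open>O(h\<^sup>m)\<close>, uniformly in the parameter, because the coefficients are bounded.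
\<close>

lemma state_ct_pulse:
  fixes A :: "'p \<Rightarrow> complex ^ 'n ^ 'n" and B :: "'p \<Rightarrow> complex ^ 'm ^ 'n"
  assumes A: "bounded (A ` P)" and Bv: "bounded ((\<lambda>t. B t *v v) ` P)"
  obtains C where "C > 0" "\<And>h t. 0 < h \<Longrightarrow> h \<le> 1 \<Longrightarrow> t \<in> P \<Longrightarrow>
      norm (state_ct (A t) (B t) (pulse h v) 1 -
        (\<Sum>k<m. (h ^ k / fact (Suc k)) *\<^sub>R (matrix_power (A t) k *v (B t *v v)))) \<le> C * h ^ m"
proof -
  obtain r where r: "\<And>t. t \<in> P \<Longrightarrow> norm (A t) \<le> r" using A unfolding bounded_iff by auto
  obtain \<beta> where \<beta>: "\<beta> > 0" "\<And>t. t \<in> P \<Longrightarrow> norm (B t *v v) \<le> \<beta>" using Bv unfolding bounded_pos by auto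
  obtain c where c: "c > 0" "\<And>(M :: complex ^ 'n ^ 'n) y. norm (M *v y) \<le> c * norm M * norm y"
    using bilinear_bounded_pos[OF bilinear_matrix_vector_mult] by metis
  show thesis
  proof (rule matrix_exp_taylor[where r = r and m = m and 'n = 'n])
    fix C assume "C > 0" and taylor: "\<And>A :: complex ^ 'n ^ 'n. \<And>s. norm A \<le> r \<Longrightarrow> 0 \<le> s \<Longrightarrow> s \<le> 1 \<Longrightarrow>
      norm (matrix_exp (s *\<^sub>R A) - (\<Sum>k<m. (s ^ k / fact k) *\<^sub>R matrix_power A k)) \<le> C * s ^ m"
    show thesis
    proof (rule that[of "c * C * \<beta>"])
      show "c * C * \<beta> > 0" using c \<open>C > 0\<close> \<beta> by simp
      fix h t assume h: "0 < h" "h \<le> (1 :: real)" and t: "t \<in> P"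
      define y where "y = B t *v v"
      define E where "E \<tau> = (1 / h) *\<^sub>R (matrix_exp ((1 - \<tau>) *\<^sub>R A t) *v y)" for \<tau>
      define p where "p \<tau> = (1 / h) *\<^sub>R (\<Sum>k<m. ((1 - \<tau>) ^ k / fact k) *\<^sub>R (matrix_power (A t) k *v y))" for \<tau>
      define I where "I = (\<Sum>k<m. (h ^ k / fact (Suc k)) *\<^sub>R (matrix_power (A t) k *v y))"
      have integrand: "(\<lambda>\<tau>. matrix_exp ((1 - \<tau>) *\<^sub>R A t) *v (B t *v pulse h v \<tau>)) =
          (\<lambda>\<tau>. if \<tau> \<in> {1 - h..1} then E \<tau> else 0)"
        by (auto simp: fun_eq_iff pulse_def E_def y_def scaleR_eq_smult vec.scale)
      have int: "(\<lambda>\<tau>. if \<tau> \<in> {1 - h..1} then E \<tau> else 0) absolutely_integrable_on {0..1}"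
        using absolutely_integrable_state[OF absolutely_integrable_pulse[OF h, where v = v], of "A t" "B t"]
        unfolding integrand .
      then have state: "((\<lambda>\<tau>. if \<tau> \<in> {1 - h..1} then E \<tau> else 0) has_integral
          state_ct (A t) (B t) (pulse h v) 1) {0..1}"
        unfolding state_ct_def integrand by (rule has_integral_set_lebesgue)
      have "(E has_integral state_ct (A t) (B t) (pulse h v) 1) {1 - h..1}"
        using has_integral_restrict[THEN iffD1, OF _ state] h by simp
      moreover have "(p has_integral I) {1 - h..1}"
        unfolding p_def I_def using h by (intro has_integral_taylor_polynomial)
      ultimately have diff: "((\<lambda>\<tau>. E \<tau> - p \<tau>) has_integral state_ct (A t) (B t) (pulse h v) 1 - I)
          (cbox (1 - h) 1)"
        by (simp add: has_integral_diff)
      have bound: "norm (E \<tau> - p \<tau>) \<le> (1 / h) * (c * (C * h ^ m) * \<beta>)" if "\<tau> \<in> {1 - h..1}" for \<tau>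
      proof -
        define D where "D = matrix_exp ((1 - \<tau>) *\<^sub>R A t) - (\<Sum>k<m. ((1 - \<tau>) ^ k / fact k) *\<^sub>R matrix_power (A t) k)"
        have "(\<Sum>k<m. ((1 - \<tau>) ^ k / fact k) *\<^sub>R matrix_power (A t) k) *v y
            = (\<Sum>k<m. ((1 - \<tau>) ^ k / fact k) *\<^sub>R (matrix_power (A t) k *v y))"
          by (induction m) (simp_all add: matrix_vector_mult_add_rdistrib scaleR_matrix_mult_vec)
        then have "E \<tau> - p \<tau> = (1 / h) *\<^sub>R (D *v y)"
          by (simp add: E_def p_def D_def matrix_vector_mult_diff_rdistrib scaleR_diff_right)
        then have "norm (E \<tau> - p \<tau>) = (1 / h) * norm (D *v y)" using h by simp
        also have "\<dots> \<le> (1 / h) * (c * norm D * norm y)"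
          using c h by (intro mult_left_mono) auto
        also have "\<dots> \<le> (1 / h) * (c * (C * h ^ m) * \<beta>)"
        proof -
          have "norm D \<le> C * (1 - \<tau>) ^ m"
            unfolding D_def using that h r[OF t] by (intro taylor) auto
          also have "\<dots> \<le> C * h ^ m"
            using that h \<open>C > 0\<close> by (intro mult_left_mono power_mono) auto
          finally have "norm D \<le> C * h ^ m" .
          moreover have "norm y \<le> \<beta>" using \<beta> t by (simp add: y_def)
          ultimately show ?thesis
            using c h \<open>C > 0\<close> by (intro mult_left_mono mult_mono) auto
        qed
        finally show ?thesis .
      qed
      have "norm (state_ct (A t) (B t) (pulse h v) 1 - I) \<le> (1 / h) * (c * (C * h ^ m) * \<beta>) * measure lborel (cbox (1 - h) 1)"
        by (rule has_integral_bound[OF _ diff]) (use bound c h \<beta> \<open>C > 0\<close> in auto)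
      also have "\<dots> = c * C * \<beta> * h ^ m" using h by simp
      finally show "norm (state_ct (A t) (B t) (pulse h v) 1 -
          (\<Sum>k<m. (h ^ k / fact (Suc k)) *\<^sub>R (matrix_power (A t) k *v (B t *v v)))) \<le> c * C * \<beta> * h ^ m"
        by (simp add: I_def y_def)
    qed
  qed
qed

text \<open>
  Once the vectors \<open>A\<^sup>k B v\<close> with \<open>k < m\<close> are known to lie in the closure, their share can be
  subtracted from the state produced by a pulse.  What remains is \<open>h\<^sup>m / (m+1)!\<close> times \<open>A\<^sup>m B v\<close>, up to
  an error of order \<open>h\<^sup>m\<^sup>+\<^sup>1\<close>, and one divides by \<open>h\<^sup>m / (m+1)!\<close>.
\<close>

lemma orbit_in_closure_ct:
  fixes A :: "'p \<Rightarrow> complex ^ 'n ^ 'n" and B :: "'p \<Rightarrow> complex ^ 'm ^ 'n"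
  assumes A: "bounded (A ` P)" and Bv: "bounded ((\<lambda>t. B t *v v) ` P)"
  shows "(\<lambda>t. matrix_power (A t) k *v (B t *v v)) \<in> uniform_closure P (reachable_states_ct A B)"
proof (induction k rule: less_induct)
  case (less m)
  let ?L = "uniform_closure P (reachable_states_ct A B)"
  have L: "complex_subspace ?L"
    by (intro complex_subspace_uniform_closure complex_subspace_reachable_states_ct)
  define x where "x k t = matrix_power (A t) k *v (B t *v v)" for k t
  obtain C where C: "C > 0" "\<And>h t. 0 < h \<Longrightarrow> h \<le> 1 \<Longrightarrow> t \<in> P \<Longrightarrow>
      norm (state_ct (A t) (B t) (pulse h v) 1 - (\<Sum>k<Suc m. (h ^ k / fact (Suc k)) *\<^sub>R x k t)) \<le> C * h ^ Suc m"
    unfolding x_def using state_ct_pulse[OF A Bv, where m = "Suc m"] by blast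
  have "x m \<in> ?L"
  proof (rule uniform_closure_closed)
    fix \<epsilon> :: real assume \<epsilon>: "\<epsilon> > 0"
    define F where "F = (fact (Suc m) :: real)"
    have F: "F > 0" by (simp add: F_def)
    \<comment> \<open>small enough for the scaled remainder \<open>F * C * h\<close> to be below \<open>\<epsilon>\<close>\<close>
    define h where "h = min 1 (\<epsilon> / (2 * F * C))"
    have h: "0 < h" "h \<le> 1" using \<epsilon> F C by (simp_all add: h_def)
    have "h \<le> \<epsilon> / (2 * F * C)" by (simp add: h_def)
    then have h_small: "F * C * h \<le> \<epsilon> / 2" using F C by (simp add: field_simps)
    define g where "g t = complex_of_real (F / h ^ m) *s (state_ct (A t) (B t) (pulse h v) 1 +
        (\<Sum>k<m. complex_of_real (- (h ^ k / fact (Suc k))) *s x k t))" for t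
    have "(\<lambda>t. state_ct (A t) (B t) (pulse h v) 1) \<in> ?L"
      unfolding reachable_states_ct_def
      using absolutely_integrable_pulse[OF h] by (intro uniform_closure_superset) blast
    moreover have "x k \<in> ?L" if "k < m" for k
      using less.IH[OF that] by (simp add: x_def[abs_def])
    ultimately have "g \<in> ?L"
      unfolding g_def
      by (intro complex_subspace_scale[OF L] complex_subspace_add[OF L] complex_subspace_sum[OF L]) simp_all
    moreover have "norm (g t - x m t) < \<epsilon>" if t: "t \<in> P" for t
    proof -
      define d where "d = state_ct (A t) (B t) (pulse h v) 1 - (\<Sum>k<Suc m. (h ^ k / fact (Suc k)) *\<^sub>R x k t)"
      have "(F / h ^ m) *\<^sub>R ((h ^ m / F) *\<^sub>R x m t) = x m t" using F h by simp
      then have "g t - x m t = (F / h ^ m) *\<^sub>R d"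
        by (simp add: g_def d_def F_def scaleR_eq_smult[symmetric] sum_negf scaleR_diff_right
            scaleR_add_right del: fact_Suc of_real_divide of_real_power of_real_minus)
      then have "norm (g t - x m t) = F / h ^ m * norm d" using F h by simp
      also have "\<dots> \<le> F / h ^ m * (C * h ^ Suc m)"
        using C(2)[OF h t] F h unfolding d_def by (intro mult_left_mono) auto
      also have "\<dots> = F * C * h" using h by simp
      also have "\<dots> < \<epsilon>" using h_small \<epsilon> by simp
      finally show ?thesis .
    qed
    ultimately show "\<exists>g\<in>?L. \<forall>t\<in>P. norm (g t - x m t) < \<epsilon>" by (intro bexI[rotated] ballI)
  qed
  then show ?case by (simp add: x_def[abs_def])
qed

section \<open>States in discrete time and conclusion\<close>

text \<open>
  Here the inputs are listed backwards from the final time, so that input sequences of different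
  lengths can be added after padding with zeros.
\<close>

definition reachable_states_dt ::
    "('p \<Rightarrow> complex ^ 'n ^ 'n) \<Rightarrow> ('p \<Rightarrow> complex ^ 'm ^ 'n) \<Rightarrow> ('p \<Rightarrow> complex ^ 'n) set" where
  "reachable_states_dt A B = {\<lambda>t. \<Sum>k<T. matrix_power (A t) k *v (B t *v w k) | T w. True}"

lemma reachable_states_dt_iff:
  "g \<in> reachable_states_dt A B \<longleftrightarrow> (\<exists>T u. g = (\<lambda>t. state_dt (A t) (B t) u T))"
proof -
  have rev: "state_dt M N u T = (\<Sum>k<T. matrix_power M k *v (N *v u (T - 1 - k)))"
    for M :: "complex ^ 'b ^ 'b" and N :: "complex ^ 'c ^ 'b" and u T
    unfolding state_dt_def
    by (subst sum.nat_diff_reindex[symmetric]) (auto intro!: sum.cong)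
  show ?thesis
  proof
    assume "g \<in> reachable_states_dt A B"
    then obtain T w where "g = (\<lambda>t. \<Sum>k<T. matrix_power (A t) k *v (B t *v w k))"
      unfolding reachable_states_dt_def by blast
    then have "g = (\<lambda>t. state_dt (A t) (B t) (\<lambda>k. w (T - 1 - k)) T)"
      by (auto simp: rev fun_eq_iff intro!: sum.cong)
    then show "\<exists>T u. g = (\<lambda>t. state_dt (A t) (B t) u T)" by blast
  next
    assume "\<exists>T u. g = (\<lambda>t. state_dt (A t) (B t) u T)"
    then obtain T u where "g = (\<lambda>t. \<Sum>k<T. matrix_power (A t) k *v (B t *v u (T - 1 - k)))"
      unfolding rev by blast
    then show "g \<in> reachable_states_dt A B"
      unfolding reachable_states_dt_def
      by (intro CollectI exI[of _ T] exI[of _ "\<lambda>k. u (T - 1 - k)"]) simp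
  qed
qed

lemma complex_subspace_reachable_states_dt:
  fixes A :: "'p \<Rightarrow> complex ^ 'n ^ 'n" and B :: "'p \<Rightarrow> complex ^ 'm ^ 'n"
  shows "complex_subspace (reachable_states_dt A B)"
  unfolding complex_subspace_def
proof (intro conjI ballI allI)
  have "(\<lambda>_. 0) = (\<lambda>t. \<Sum>k<0. matrix_power (A t) k *v (B t *v (0 :: complex ^ 'm)))" by simp
  then show "(\<lambda>_. 0) \<in> reachable_states_dt A B"
    unfolding reachable_states_dt_def by (intro CollectI exI[of _ 0] exI[of _ "\<lambda>_. 0"]) simp
next
  fix f g assume "f \<in> reachable_states_dt A B" "g \<in> reachable_states_dt A B"
  then obtain S T u w where f: "f = (\<lambda>t. \<Sum>k<S. matrix_power (A t) k *v (B t *v u k))"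
    and g: "g = (\<lambda>t. \<Sum>k<T. matrix_power (A t) k *v (B t *v w k))"
    unfolding reachable_states_dt_def by blast
  define u' where "u' k = (if k < S then u k else 0)" for k
  define w' where "w' k = (if k < T then w k else 0)" for k
  have "f t = (\<Sum>k<S + T. matrix_power (A t) k *v (B t *v u' k))" for t
    unfolding f by (rule sum.mono_neutral_cong_left) (auto simp: u'_def)
  moreover have "g t = (\<Sum>k<S + T. matrix_power (A t) k *v (B t *v w' k))" for t
    unfolding g by (rule sum.mono_neutral_cong_left) (auto simp: w'_def)
  ultimately have "(\<lambda>t. f t + g t)
      = (\<lambda>t. \<Sum>k<S + T. matrix_power (A t) k *v (B t *v (u' k + w' k)))"
    by (simp add: matrix_vector_right_distrib sum.distrib)
  then show "(\<lambda>t. f t + g t) \<in> reachable_states_dt A B"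
    unfolding reachable_states_dt_def
    by (intro CollectI exI[of _ "S + T"] exI[of _ "\<lambda>k. u' k + w' k"]) simp
next
  fix c f assume "f \<in> reachable_states_dt A B"
  then obtain T u where f: "f = (\<lambda>t. \<Sum>k<T. matrix_power (A t) k *v (B t *v u k))"
    unfolding reachable_states_dt_def by blast
  have "(\<lambda>t. c *s f t) = (\<lambda>t. \<Sum>k<T. matrix_power (A t) k *v (B t *v (c *s u k)))"
    unfolding f by (simp add: vec.scale vec.scale_sum_right)
  then show "(\<lambda>t. c *s f t) \<in> reachable_states_dt A B"
    unfolding reachable_states_dt_def
    by (intro CollectI exI[of _ T] exI[of _ "\<lambda>k. c *s u k"]) simp
qed

lemma orbit_in_closure_dt:
  fixes A :: "'p \<Rightarrow> complex ^ 'n ^ 'n" and B :: "'p \<Rightarrow> complex ^ 'm ^ 'n"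
  shows "(\<lambda>t. matrix_power (A t) k *v (B t *v v)) \<in> uniform_closure P (reachable_states_dt A B)"
proof (rule uniform_closure_superset)
  have "matrix_power (A t) k *v (B t *v v)
      = (\<Sum>j<Suc k. matrix_power (A t) j *v (B t *v (if j = k then v else 0)))" for t
    by simp
  then show "(\<lambda>t. matrix_power (A t) k *v (B t *v v)) \<in> reachable_states_dt A B"
    unfolding reachable_states_dt_def
    by (intro CollectI exI[of _ "Suc k"] exI[of _ "\<lambda>j. if j = k then v else 0"]) simp
qed

text \<open>
  Half of \<open>\<epsilon>\<close> is used because passing to the supremum makes a strict bound weak.
\<close>

lemma uniform_closure_SUP_less:
  assumes "f \<in> uniform_closure P L" "P \<noteq> {}" "\<epsilon> > 0"
  obtains g where "g \<in> L" "(SUP t\<in>P. norm (g t - f t)) < \<epsilon>"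
proof -
  obtain g where g: "g \<in> L" "\<forall>t\<in>P. norm (g t - f t) < \<epsilon> / 2"
    using uniform_closureD[OF assms(1), of "\<epsilon> / 2"] \<open>\<epsilon> > 0\<close> by auto
  have "(SUP t\<in>P. norm (g t - f t)) \<le> \<epsilon> / 2"
    using g \<open>P \<noteq> {}\<close> by (intro cSUP_least) (auto intro: less_imp_le)
  then show thesis using that[of g] g \<open>\<epsilon> > 0\<close> by simp
qed

lemma uniformly_ensemble_reachable_ctI:
  assumes "P \<noteq> {}"
    and dense: "\<And>f. continuous_on P f \<Longrightarrow> f \<in> uniform_closure P (reachable_states_ct A B)"
  shows "uniformly_ensemble_reachable_ct P A B"
  unfolding uniformly_ensemble_reachable_ct_def
proof (intro allI impI)
  fix f :: "'a \<Rightarrow> complex ^ 'b" and \<epsilon> :: real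
  assume "continuous_on P f" "\<epsilon> > 0"
  then obtain g where "g \<in> reachable_states_ct A B" "(SUP t\<in>P. norm (g t - f t)) < \<epsilon>"
    using uniform_closure_SUP_less[OF dense \<open>P \<noteq> {}\<close>] by blast
  then obtain u where "u absolutely_integrable_on {0..1}"
      "(SUP t\<in>P. norm (state_ct (A t) (B t) u 1 - f t)) < \<epsilon>"
    unfolding reachable_states_ct_def by blast
  then show "\<exists>T\<ge>0. \<exists>u. u absolutely_integrable_on {0..T} \<and>
      (SUP t\<in>P. norm (state_ct (A t) (B t) u T - f t)) < \<epsilon>"
    by (intro exI[of _ 1]) auto
qed

lemma uniformly_ensemble_reachable_dtI:
  assumes "P \<noteq> {}"
    and dense: "\<And>f. continuous_on P f \<Longrightarrow> f \<in> uniform_closure P (reachable_states_dt A B)"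
  shows "uniformly_ensemble_reachable_dt P A B"
  unfolding uniformly_ensemble_reachable_dt_def
proof (intro allI impI)
  fix f :: "'a \<Rightarrow> complex ^ 'b" and \<epsilon> :: real
  assume "continuous_on P f" "\<epsilon> > 0"
  then obtain g where "g \<in> reachable_states_dt A B" "(SUP t\<in>P. norm (g t - f t)) < \<epsilon>"
    using uniform_closure_SUP_less[OF dense \<open>P \<noteq> {}\<close>] by blast
  then show "\<exists>T u. (SUP t\<in>P. norm (state_dt (A t) (B t) u T - f t)) < \<epsilon>"
    unfolding reachable_states_dt_iff by blast
qed

theorem theorem4p5:
  fixes a b :: real
    and A :: "real \<Rightarrow> complex ^ 'n ^ 'n"
    and B :: "real \<Rightarrow> complex ^ 'm ^ 'n"
  assumes "a \<le> b"
    and "continuous_on {a..b} A"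
    and "continuous_on {a..b} B"
    and "pointwise_reachable {a..b} A B"
    and "\<exists>v :: complex ^ 'm. \<forall>\<theta>\<in>{a..b}. B \<theta> *v v \<noteq> 0"
  shows "(\<exists>K :: real \<Rightarrow> complex ^ 'n ^ 'm. continuous_on {a..b} K \<and>
            uniformly_ensemble_reachable_ct {a..b} (\<lambda>\<theta>. A \<theta> + B \<theta> ** K \<theta>) B) \<and>
         (\<exists>K :: real \<Rightarrow> complex ^ 'n ^ 'm. continuous_on {a..b} K \<and>
            uniformly_ensemble_reachable_dt {a..b} (\<lambda>\<theta>. A \<theta> + B \<theta> ** K \<theta>) B)"
proof -
  obtain v :: "complex ^ 'm" where v: "\<And>t. t \<in> {a..b} \<Longrightarrow> B t *v v \<noteq> 0" using assms by blast
  obtain K :: "real \<Rightarrow> complex ^ 'n ^ 'm" where K: "continuous_on {a..b} K"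
    and det: "\<And>t. t \<in> {a..b} \<Longrightarrow>
       det (col_matrix (\<lambda>k. matrix_power (A t + B t ** K t) k *v (B t *v v))) \<noteq> 0"
    and shift: "\<And>t. t \<in> {a..b} \<Longrightarrow>
       matrix_power (A t + B t ** K t) CARD('n) *v (B t *v v) = complex_of_real t *s (B t *v v)"
    using ex_cyclic_feedback[OF assms(1-4) v, of thesis] by blast
  define G where "G t = A t + B t ** K t" for t
  have G: "continuous_on {a..b} G"
    unfolding G_def by (intro continuous_on_add continuous_on_matrix_mult assms K)
  have Bv: "continuous_on {a..b} (\<lambda>t. B t *v v)"
    by (intro continuous_on_mult_vec assms continuous_on_const)
  have bounded: "bounded (f ` {a..b})" if "continuous_on {a..b} f" for f :: "real \<Rightarrow> 'z::metric_space"
    using that by (intro compact_imp_bounded compact_continuous_image) auto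
  have "uniformly_ensemble_reachable_ct {a..b} G B"
  proof (rule uniformly_ensemble_reachable_ctI)
    fix f :: "real \<Rightarrow> complex ^ 'n" assume f: "continuous_on {a..b} f"
    show "f \<in> uniform_closure {a..b} (reachable_states_ct G B)"
      by (rule cyclic_shift_dense[OF complex_subspace_reachable_states_ct G Bv
            det[folded G_def] shift[folded G_def] orbit_in_closure_ct[OF bounded[OF G] bounded[OF Bv]] f])
  qed (use \<open>a \<le> b\<close> in simp)
  moreover have "uniformly_ensemble_reachable_dt {a..b} G B"
  proof (rule uniformly_ensemble_reachable_dtI)
    fix f :: "real \<Rightarrow> complex ^ 'n" assume f: "continuous_on {a..b} f"
    show "f \<in> uniform_closure {a..b} (reachable_states_dt G B)"
      by (rule cyclic_shift_dense[OF complex_subspace_reachable_states_dt G Bv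
            det[folded G_def] shift[folded G_def] orbit_in_closure_dt f])
  qed (use \<open>a \<le> b\<close> in simp)
  ultimately show ?thesis using K unfolding G_def by blast
qed

end
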